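(* Let $A,B$ be the matrices defined in the context (uniform grid, Dirichlet boundary conditions), let $$\widehat C=(|w_{-1}|-10w_2)(\alpha+\beta)-(r+\lambda)+\lambda\sqrt{L_y\|f\|_\infty},\qquad\widehat C^+=\max(\widehat C,0).$$ Let $\theta\in[\frac14,\frac12]$, $\nu\in\,]0,\frac1\theta[$, $T>0$, and let $$R_\theta(z)=\frac{1+(1-2\theta)z+(\frac12-2\theta+\theta^2)z^2}{(1-\theta z)^2}$$ be the stability function of the DIRK scheme. Then the DIRK scheme is stable in the $\ell_2$-norm in the sense that there is a constant $\gamma$, independent of $\Delta t$, $\Delta x$ and $\Delta y$, such that $$\|R_\theta(\Delta t(A+B))\|_2^n\le e^{\gamma T\widehat C^+}\quad\text{whenever } n=0,1,2,\dots\text{ with } n\Delta t\le T\text{ and }\widehat C\Delta t\le\nu.$$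
   Context: Parameters: $\alpha,\beta,\sigma,\lambda,\Delta t>0$, $\mu,r\in\mathbb R$; $f$ is a bounded probability density on $\mathbb R$, $\|f\|_\infty=\sup_{\xi}|f(\xi)|<\infty$, $L_y=y_{\max}-y_{\min}$. The real weights satisfy $\sum_{k=-1}^2w_k=0$, $\sum_{k=-1}^2kw_k=1$, $\sum_{k=-1}^2k^2w_k=0$, $w_2\le0$. Grid: $x_{\min}=x_{-1}<x_0<\dots<x_{m_1}<x_{m_1+1}=x_{\max}$ and $y_{\min}=y_{-1}<y_0<\dots<y_{m_2}<y_{m_2+1}=y_{\max}$ are uniform meshes with widths $\Delta x,\Delta y$. The unknowns are $V=(V_{i,j})_{0\le i\le m_1,0\le j\le m_2}$ (entry $i(m_2+1)+j$); values at indices $-1$, $m_1+1$ (in $i$) and $-1$, $m_2+1$ (in $j$) are boundary values. Put $a_i=\alpha(\mu-x_i)$, $b_j=-\beta y_j$, $c^+=\max(c,0)$, $c^-=\min(c,0)$. Standing assumption: $a(x)=\alpha(\mu-x)$ and $b(y)=-\beta y$ change sign within the domain, being positive near $x_{\min},y_{\min}$ and negative near $x_{\max},y_{\max}$: $a_0>0>a_{m_1}$, $b_0>0>b_{m_2}$ (so no stencil below extends beyond the boundary nodes). The matrices $A,B$ are obtained from the following formulas by setting all boundary values equal to zero: $(AV)_{i,j}=\frac{\sigma^2}{2}\frac{V_{i-1,j}-2V_{i,j}+V_{i+1,j}}{\Delta x^2}-(r+\lambda)V_{i,j}+a_i^+\frac{w_2V_{i+2,j}+w_1V_{i+1,j}+w_0V_{i,j}+w_{-1}V_{i-1,j}}{\Delta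 x}+a_i^-\frac{-w_{-1}V_{i+1,j}-w_0V_{i,j}-w_1V_{i-1,j}-w_2V_{i-2,j}}{\Delta x}+b_j^+\frac{w_2V_{i,j+2}+w_1V_{i,j+1}+w_0V_{i,j}+w_{-1}V_{i,j-1}}{\Delta y}+b_j^-\frac{-w_{-1}V_{i,j+1}-w_0V_{i,j}-w_1V_{i,j-1}-w_2V_{i,j-2}}{\Delta y},$ $(BV)_{i,j}=\lambda\sum_{\ell=-1}^{m_2}\int_{y_\ell}^{y_{\ell+1}}\Big(\frac{y_{\ell+1}-\xi}{\Delta y}V_{i,\ell}+\frac{\xi-y_\ell}{\Delta y}V_{i,\ell+1}\Big)f(\xi-y_j)\,d\xi.$ The DIRK scheme applied to $\frac{dV}{dt}=(A+B)V$ is: $(I-\theta\Delta t(A+B))\hat V^{n+1}=V^n+(1-\theta)\Delta t(A+B)V^n$, $(I-\theta\Delta t(A+B))V^{n+1}=V^n+\frac12\Delta t(A+B)V^n+(\frac12-\theta)\Delta t(A+B)\hat V^{n+1}$, so that $V^{n+1}=R_\theta(\Delta t(A+B))V^n$. For a square matrix $M$, $R_\theta(M)=(I-\theta M)^{-2}\big(I+(1-2\theta)M+(\frac12-2\theta+\theta^2)M^2\big)$. The vector norm is $\|V\|_2=\sqrt{\langle V,V\rangle}$ with $\langle U,V\rangle=\Delta x\Delta y\sum_kU_kV_k$, and $\|M\|_2$ is the induced (spectral) matrix norm. *)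

theory Defs
  imports
    "HOL-Analysis.Analysis"
    "Jordan_Normal_Form.Gauss_Jordan_Elimination"
begin

text \<open>Uniform mesh of \<open>[lo, hi]\<close> with interior nodes \<open>0, \<dots>, m\<close> and boundary nodes \<open>-1\<close> and
  \<open>m + 1\<close>. Node indices are integers.\<close>

definition mesh_width :: "real \<Rightarrow> real \<Rightarrow> nat \<Rightarrow> real" where
  "mesh_width lo hi m = (hi - lo) / real (m + 2)"

definition mesh_node :: "real \<Rightarrow> real \<Rightarrow> nat \<Rightarrow> int \<Rightarrow> real" where
  "mesh_node lo hi m i = lo + of_int (i + 1) * mesh_width lo hi m"

abbreviation pos_part :: "real \<Rightarrow> real" where
  "pos_part c \<equiv> max c 0"

abbreviation neg_part :: "real \<Rightarrow> real" where
  "neg_part c \<equiv> min c 0"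

text \<open>A vector of unknowns, with \<open>V\<^sub>i\<^sub>,\<^sub>j\<close> at position \<open>i (m\<^sub>2 + 1) + j\<close>, as a grid function:
  all values outside the interior index range, in particular the boundary values, are zero.\<close>

definition grid_fun :: "nat \<Rightarrow> nat \<Rightarrow> real vec \<Rightarrow> int \<Rightarrow> int \<Rightarrow> real" where
  "grid_fun m1 m2 v i j =
     (if 0 \<le> i \<and> i \<le> int m1 \<and> 0 \<le> j \<and> j \<le> int m2
      then v $ (nat i * (m2 + 1) + nat j) else 0)"

text \<open>The matrix of a linear formula \<open>F\<close> on grid functions: column \<open>l\<close> holds the values of \<open>F\<close>
  at the \<open>l\<close>-th unit vector.\<close>

definition grid_matrix ::
  "nat \<Rightarrow> nat \<Rightarrow> ((int \<Rightarrow> int \<Rightarrow> real) \<Rightarrow> int \<Rightarrow> int \<Rightarrow> real) \<Rightarrow> real mat" where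
  "grid_matrix m1 m2 F =
     (let N = (m1 + 1) * (m2 + 1) in
      mat N N (\<lambda>(k, l). F (grid_fun m1 m2 (unit_vec N l))
                          (int (k div (m2 + 1))) (int (k mod (m2 + 1)))))"

definition upwind_forward :: "(int \<Rightarrow> real) \<Rightarrow> (int \<Rightarrow> real) \<Rightarrow> int \<Rightarrow> real" where
  "upwind_forward w u i =
     w 2 * u (i + 2) + w 1 * u (i + 1) + w 0 * u i + w (-1) * u (i - 1)"

definition upwind_backward :: "(int \<Rightarrow> real) \<Rightarrow> (int \<Rightarrow> real) \<Rightarrow> int \<Rightarrow> real" where
  "upwind_backward w u i =
     - w (-1) * u (i + 1) - w 0 * u i - w 1 * u (i - 1) - w 2 * u (i - 2)"

definition A_formula ::
  "real \<Rightarrow> real \<Rightarrow> real \<Rightarrow> real \<Rightarrow> real \<Rightarrow> real \<Rightarrow> (int \<Rightarrow> real) \<Rightarrow>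
   real \<Rightarrow> real \<Rightarrow> real \<Rightarrow> real \<Rightarrow> nat \<Rightarrow> nat \<Rightarrow>
   (int \<Rightarrow> int \<Rightarrow> real) \<Rightarrow> int \<Rightarrow> int \<Rightarrow> real" where
  "A_formula \<alpha> \<beta> \<sigma> lam \<mu> r w xmin xmax ymin ymax m1 m2 V i j =
     (let dx = mesh_width xmin xmax m1;
          dy = mesh_width ymin ymax m2;
          a = \<alpha> * (\<mu> - mesh_node xmin xmax m1 i);
          b = - \<beta> * mesh_node ymin ymax m2 j
      in \<sigma>\<^sup>2 / 2 * ((V (i - 1) j - 2 * V i j + V (i + 1) j) / dx\<^sup>2)
         - (r + lam) * V i j
         + pos_part a * (upwind_forward w (\<lambda>k. V k j) i / dx)
         + neg_part a * (upwind_backward w (\<lambda>k. V k j) i / dx)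
         + pos_part b * (upwind_forward w (\<lambda>k. V i k) j / dy)
         + neg_part b * (upwind_backward w (\<lambda>k. V i k) j / dy))"

definition B_formula ::
  "real \<Rightarrow> (real \<Rightarrow> real) \<Rightarrow> real \<Rightarrow> real \<Rightarrow> nat \<Rightarrow>
   (int \<Rightarrow> int \<Rightarrow> real) \<Rightarrow> int \<Rightarrow> int \<Rightarrow> real" where
  "B_formula lam f ymin ymax m2 V i j =
     (let dy = mesh_width ymin ymax m2;
          y = mesh_node ymin ymax m2
      in lam * (\<Sum>l = -1..int m2.
           (LINT \<xi>:{y l..y (l + 1)}|lebesgue.
              ((y (l + 1) - \<xi>) / dy * V i l + (\<xi> - y l) / dy * V i (l + 1)) * f (\<xi> - y j))))"

definition A_matrix ::
  "real \<Rightarrow> real \<Rightarrow> real \<Rightarrow> real \<Rightarrow> real \<Rightarrow> real \<Rightarrow> (int \<Rightarrow> real) \<Rightarrow>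
   real \<Rightarrow> real \<Rightarrow> real \<Rightarrow> real \<Rightarrow> nat \<Rightarrow> nat \<Rightarrow> real mat" where
  "A_matrix \<alpha> \<beta> \<sigma> lam \<mu> r w xmin xmax ymin ymax m1 m2 =
     grid_matrix m1 m2 (A_formula \<alpha> \<beta> \<sigma> lam \<mu> r w xmin xmax ymin ymax m1 m2)"

definition B_matrix ::
  "real \<Rightarrow> (real \<Rightarrow> real) \<Rightarrow> real \<Rightarrow> real \<Rightarrow> nat \<Rightarrow> nat \<Rightarrow> real mat" where
  "B_matrix lam f ymin ymax m1 m2 = grid_matrix m1 m2 (B_formula lam f ymin ymax m2)"

definition grid_norm :: "real \<Rightarrow> real \<Rightarrow> real vec \<Rightarrow> real" where
  "grid_norm dx dy v = sqrt (dx * dy * (\<Sum>k<dim_vec v. v $ k * v $ k))"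

definition grid_matrix_norm :: "real \<Rightarrow> real \<Rightarrow> real mat \<Rightarrow> real" where
  "grid_matrix_norm dx dy M =
     (SUP v \<in> {v \<in> carrier_vec (dim_col M). v \<noteq> 0\<^sub>v (dim_col M)}.
        grid_norm dx dy (M *\<^sub>v v) / grid_norm dx dy v)"

text \<open>The stability function at a square matrix. The inverse is meaningful only if
  \<open>I - \<theta>M\<close> is invertible.\<close>

definition dirk_R :: "real \<Rightarrow> real mat \<Rightarrow> real mat" where
  "dirk_R \<theta> M =
     (let I = 1\<^sub>m (dim_row M) in
      the (mat_inverse (I - \<theta> \<cdot>\<^sub>m M)) ^\<^sub>m 2 *
      (I + (1 - 2 * \<theta>) \<cdot>\<^sub>m M + (1 / 2 - 2 * \<theta> + \<theta>\<^sup>2) \<cdot>\<^sub>m (M ^\<^sub>m 2)))"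

definition C_hat ::
  "real \<Rightarrow> real \<Rightarrow> real \<Rightarrow> real \<Rightarrow> (int \<Rightarrow> real) \<Rightarrow> (real \<Rightarrow> real) \<Rightarrow> real \<Rightarrow> real \<Rightarrow> real" where
  "C_hat \<alpha> \<beta> lam r w f ymin ymax =
     (\<bar>w (-1)\<bar> - 10 * w 2) * (\<alpha> + \<beta>) - (r + lam)
     + lam * sqrt ((ymax - ymin) * (SUP \<xi>. \<bar>f \<xi>\<bar>))"

end

theory Submission
  imports Defs "Jordan_Normal_Form.Determinant"
begin

text \<open>Everything rests on the one-sided bound \<open>\<langle>V, (A + B) V\<rangle> \<le> C \<langle>V, V\<rangle>\<close> with the constant
  \<open>C = C_hat\<close>. The weights satisfy \<open>w\<^sub>1 = - w\<^sub>-\<^sub>1 - 4 w\<^sub>2\<close> and \<open>w\<^sub>0 = 3 w\<^sub>2\<close>, so an upwind difference is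
  \<open>- w\<^sub>-\<^sub>1\<close> times a central difference plus \<open>w\<^sub>2\<close> times a one-sided one; after summation by parts
  the former costs \<open>\<bar>w\<^sub>-\<^sub>1\<bar>\<close> and the latter \<open>-5 w\<^sub>2\<close> per direction of the wind, times the slope of
  the coefficient. The integral operator is bounded by Jensen's inequality for its subprobability
  weights together with the bound \<open>\<parallel>f\<parallel>\<^sub>\<infinity> \<Delta>y\<close> on each weight.

  For the time discretisation let \<open>W = \<Delta>t (A + B)\<close> and \<open>v = (I - \<theta>W)\<^sup>2 u\<close>, let \<open>N u\<close> be the numerator
  of the stability function applied to \<open>u\<close>, and put \<open>q = W u\<close> and \<open>x = u - (2\<theta> - 1/2) q\<close>. Then
  \<open>|v|\<^sup>2 - |N u|\<^sup>2 = - 2 \<langle>x, W x\<rangle> - (1 - 2\<theta>)\<^sup>2/2 \<langle>q, W q\<rangle> + (4\<theta> - 1)(1 - 2\<theta>)\<^sup>2/4 |W q|\<^sup>2\<close>,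
  whose last term is nonnegative for \<open>\<theta> \<ge> 1/4\<close>. The first two are at least \<open>- const c |v|\<^sup>2\<close> if
  \<open>\<langle>z, W z\<rangle> \<le> c |z|\<^sup>2\<close> for all \<open>z\<close>, because \<open>(I - \<theta>W)\<^sup>-\<^sup>1\<close> is bounded by \<open>1 / (1 - \<theta>\<nu>)\<close>. Hence one step
  grows by at most \<open>exp (\<gamma> c)\<close>, without any appeal to von Neumann's theorem on numerical ranges.\<close>

unbundle no vec_syntax

section \<open>Upwind stencils\<close>

text \<open>The padding by 4 on both sides leaves room for the shifts, and the zero extension
  removes every boundary term, so summation by parts becomes a mere change of index.\<close>

lemma sum_int_shift:
  fixes g :: "int \<Rightarrow> real"
  assumes "\<And>i. i \<notin> {0..m} \<Longrightarrow> g i = 0" and "\<bar>k\<bar> \<le> 4"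
  shows "(\<Sum>i = -4..m+4. g (i + k)) = (\<Sum>i = 0..m. g i)"
proof -
  have "(\<Sum>i = -4..m+4. g (i + k)) = (\<Sum>i = -4+k..m+4+k. g i)"
    by (rule sum.reindex_bij_witness[of _ "\<lambda>i. i - k" "\<lambda>i. i + k"]) auto
  also have "\<dots> = (\<Sum>i = 0..m. g i)"
    by (rule sum.mono_neutral_right) (use assms in auto)
  finally show ?thesis .
qed

text \<open>Young's inequality with weight \<open>h / 2\<close> on each product; every square is met
  twice, once as left and once as right neighbour.\<close>

lemma sum_adjacent_products_le:
  fixes u c :: "int \<Rightarrow> real"
  assumes u0: "\<And>i. i \<notin> {0..m} \<Longrightarrow> u i = 0" and c: "\<And>i. \<bar>c i\<bar> \<le> h"
  shows "(\<Sum>i = 0..m. c i * (u i * u (i + 1))) \<le> h * (\<Sum>i = 0..m. (u i)\<^sup>2)"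
proof -
  have pt: "c i * (u i * u (i + 1)) \<le> h / 2 * ((u i)\<^sup>2 + (u (i + 1))\<^sup>2)" for i
  proof -
    have "c i * (u i * u (i + 1)) \<le> \<bar>c i\<bar> * \<bar>u i * u (i + 1)\<bar>"
      by (metis abs_ge_self abs_mult)
    also have "\<dots> \<le> h * \<bar>u i * u (i + 1)\<bar>"
      by (rule mult_right_mono) (use c in auto)
    also have "\<dots> \<le> h * (((u i)\<^sup>2 + (u (i + 1))\<^sup>2) / 2)"
    proof (rule mult_left_mono)
      show "\<bar>u i * u (i + 1)\<bar> \<le> ((u i)\<^sup>2 + (u (i + 1))\<^sup>2) / 2"
        using sum_squares_ge_zero[of "u i - u (i+1)" 0] sum_squares_ge_zero[of "u i + u (i+1)" 0]
        by (simp add: abs_le_iff power2_eq_square algebra_simps)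
      show "0 \<le> h" using c[of 0] by linarith
    qed
    finally show ?thesis by (simp add: algebra_simps)
  qed
  have "(\<Sum>i = 0..m. c i * (u i * u (i + 1))) = (\<Sum>i = -4..m+4. c i * (u i * u (i + 1)))"
    using sum_int_shift[of m "\<lambda>i. c i * (u i * u (i + 1))" 0] u0 by simp
  also have "\<dots> \<le> (\<Sum>i = -4..m+4. h / 2 * ((u i)\<^sup>2 + (u (i + 1))\<^sup>2))"
    by (rule sum_mono) (rule pt)
  also have "\<dots> = h / 2 * ((\<Sum>i = -4..m+4. (u i)\<^sup>2) + (\<Sum>i = -4..m+4. (u (i + 1))\<^sup>2))"
    by (simp only: sum.distrib sum_distrib_left[symmetric])
  also have "\<dots> = h * (\<Sum>i = 0..m. (u i)\<^sup>2)"
    using sum_int_shift[of m "\<lambda>i. (u i)\<^sup>2" 0] sum_int_shift[of m "\<lambda>i. (u i)\<^sup>2" 1] u0 by simp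
  finally show ?thesis .
qed

text \<open>A shift by one makes the two neighbour sums equal, and each is at most the sum of
  squares. Diffusion therefore adds no energy.\<close>

lemma sum_second_difference_le:
  fixes u :: "int \<Rightarrow> real"
  assumes u0: "\<And>i. i \<notin> {0..m} \<Longrightarrow> u i = 0"
  shows "(\<Sum>i = 0..m. u i * (u (i - 1) - 2 * u i + u (i + 1))) \<le> 0"
proof -
  have s: "(\<Sum>i = 0..m. u i * u (i - 1)) = (\<Sum>i = 0..m. u i * u (i + 1))"
    using sum_int_shift[of m "\<lambda>i. u i * u (i - 1)" 1] sum_int_shift[of m "\<lambda>i. u i * u (i + 1)" 0] u0
    by (simp add: mult.commute)
  have "(\<Sum>i = 0..m. u i * (u (i - 1) - 2 * u i + u (i + 1)))
      = (\<Sum>i = 0..m. u i * u (i - 1)) + (\<Sum>i = 0..m. u i * u (i + 1)) - 2 * (\<Sum>i = 0..m. (u i)\<^sup>2)"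
    unfolding sum_distrib_left sum.distrib[symmetric] sum_subtractf[symmetric]
    by (rule sum.cong) (auto simp: power2_eq_square algebra_simps)
  also have "\<dots> \<le> 0"
    using sum_adjacent_products_le[of m u "\<lambda>_. 1" 1] u0 s by simp
  finally show ?thesis .
qed

text \<open>The central difference is skew-symmetric under zero extension, so only the decrement
  \<open>h\<close> of the coefficient survives: what remains is the sum of
  \<open>(c * h) * (u i * u (i + 1))\<close>.\<close>

lemma sum_central_advection_le:
  fixes u a :: "int \<Rightarrow> real"
  assumes u0: "\<And>i. i \<notin> {0..m} \<Longrightarrow> u i = 0" and a: "\<And>i. a (i + 1) = a i - h" and "0 \<le> h"
  shows "(\<Sum>i = 0..m. a i * u i * (c * (u (i + 1) - u (i - 1)))) \<le> \<bar>c\<bar> * h * (\<Sum>i = 0..m. (u i)\<^sup>2)"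
proof -
  have s: "(\<Sum>i = 0..m. a i * c * u i * u (i - 1)) = (\<Sum>i = 0..m. a (i + 1) * c * u (i + 1) * u i)"
    using sum_int_shift[of m "\<lambda>i. a i * c * u i * u (i - 1)" 1] 
      sum_int_shift[of m "\<lambda>i. a (i + 1) * c * u (i + 1) * u i" 0] u0 by simp
  have "(\<Sum>i = 0..m. a i * u i * (c * (u (i + 1) - u (i - 1))))
      = (\<Sum>i = 0..m. a i * c * u i * u (i + 1)) - (\<Sum>i = 0..m. a i * c * u i * u (i - 1))"
    unfolding sum_subtractf[symmetric] by (rule sum.cong) (auto simp: algebra_simps)
  also have "\<dots> = (\<Sum>i = 0..m. (c * h) * (u i * u (i + 1)))"
    unfolding s sum_subtractf[symmetric] by (rule sum.cong) (auto simp: a algebra_simps)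
  also have "\<dots> \<le> \<bar>c\<bar> * h * (\<Sum>i = 0..m. (u i)\<^sup>2)"
    by (rule sum_adjacent_products_le) (use u0 \<open>0 \<le> h\<close> in \<open>auto simp: abs_mult\<close>)
  finally show ?thesis .
qed

text \<open>The left-hand side is minus half the sum of \<open>p (i - 1)\<close> times the squared second difference
  at \<open>i\<close>, up to terms that only involve the increments of \<open>p\<close>.\<close>

lemma sum_one_sided_le:
  fixes u p :: "int \<Rightarrow> real"
  assumes u0: "\<And>i. i \<notin> {0..m} \<Longrightarrow> u i = 0" and p0: "\<And>i. 0 \<le> p i"
    and p: "\<And>i. p (i + 1) \<le> p i" "\<And>i. p i \<le> p (i + 1) + h"
  shows "(\<Sum>i = 0..m. p i * u i * (- u (i + 2) + 4 * u (i + 1) - 3 * u i))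
    \<le> 5 * h * (\<Sum>i = 0..m. (u i)\<^sup>2)"
proof -
  let ?S = "\<lambda>g. \<Sum>i = 0..m. g i"
  let ?Z = "\<lambda>g. \<Sum>i = -4..m+4. g i"
  have h: "0 \<le> h" using p[of 0] by linarith
  define d where "d i = u (i + 1) - 2 * u i + u (i - 1)" for i
  \<comment> \<open>The weight is taken at \<open>i - 1\<close> so that a shift turns the product of
    the two outer neighbours into \<open>p i * u i * u (i + 2)\<close>, the far term of the
    one-sided stencil.\<close>
  have "0 \<le> ?Z (\<lambda>i. p (i - 1) * (d i)\<^sup>2)"
    by (intro sum_nonneg mult_nonneg_nonneg p0) auto
  also have "\<dots> = ?Z (\<lambda>i. p (i - 1) * (u (i + 1))\<^sup>2) + 4 * ?Z (\<lambda>i. p (i - 1) * (u i)\<^sup>2)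
      + ?Z (\<lambda>i. p (i - 1) * (u (i - 1))\<^sup>2) - 4 * ?Z (\<lambda>i. p (i - 1) * u i * u (i + 1))
      - 4 * ?Z (\<lambda>i. p (i - 1) * u (i - 1) * u i) + 2 * ?Z (\<lambda>i. p (i - 1) * u (i - 1) * u (i + 1))"
    unfolding sum_distrib_left sum.distrib[symmetric] sum_subtractf[symmetric]
    by (rule sum.cong) (auto simp: d_def power2_eq_square algebra_simps)
  also have "?Z (\<lambda>i. p (i - 1) * (u (i + 1))\<^sup>2) = ?S (\<lambda>i. p (i - 2) * (u i)\<^sup>2)"
    using sum_int_shift[of m "\<lambda>i. p (i - 2) * (u i)\<^sup>2" 1] u0 by simp
  also have "?Z (\<lambda>i. p (i - 1) * (u i)\<^sup>2) = ?S (\<lambda>i. p (i - 1) * (u i)\<^sup>2)"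
    using sum_int_shift[of m "\<lambda>i. p (i - 1) * (u i)\<^sup>2" 0] u0 by simp
  also have "?Z (\<lambda>i. p (i - 1) * (u (i - 1))\<^sup>2) = ?S (\<lambda>i. p i * (u i)\<^sup>2)"
    using sum_int_shift[of m "\<lambda>i. p i * (u i)\<^sup>2" "-1"] u0 by simp
  also have "?Z (\<lambda>i. p (i - 1) * u i * u (i + 1)) = ?S (\<lambda>i. p (i - 1) * u i * u (i + 1))"
    using sum_int_shift[of m "\<lambda>i. p (i - 1) * u i * u (i + 1)" 0] u0 by simp
  also have "?Z (\<lambda>i. p (i - 1) * u (i - 1) * u i) = ?S (\<lambda>i. p i * u i * u (i + 1))"
    using sum_int_shift[of m "\<lambda>i. p i * u i * u (i + 1)" "-1"] u0 by simp
  also have "?Z (\<lambda>i. p (i - 1) * u (i - 1) * u (i + 1)) = ?S (\<lambda>i. p i * u i * u (i + 2))"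
    using sum_int_shift[of m "\<lambda>i. p i * u i * u (i + 2)" "-1"] u0 by (simp add: add.commute)
  finally have sq: "0 \<le> ?S (\<lambda>i. p (i - 2) * (u i)\<^sup>2) + 4 * ?S (\<lambda>i. p (i - 1) * (u i)\<^sup>2)
      + ?S (\<lambda>i. p i * (u i)\<^sup>2) - 4 * ?S (\<lambda>i. p (i - 1) * u i * u (i + 1))
      - 4 * ?S (\<lambda>i. p i * u i * u (i + 1)) + 2 * ?S (\<lambda>i. p i * u i * u (i + 2))" .
  have P: "?S (\<lambda>i. p i * u i * (- u (i + 2) + 4 * u (i + 1) - 3 * u i))
      = 4 * ?S (\<lambda>i. p i * u i * u (i + 1)) - 3 * ?S (\<lambda>i. p i * (u i)\<^sup>2) - ?S (\<lambda>i. p i * u i * u (i + 2))"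
    unfolding sum_distrib_left sum.distrib[symmetric] sum_subtractf[symmetric]
    by (rule sum.cong) (auto simp: power2_eq_square algebra_simps)
  have inc: "p (i - 1) \<le> p i + h" "p i \<le> p (i - 1)" "p (i - 2) \<le> p i + 2 * h" for i
    using p(1)[of "i - 1"] p(2)[of "i - 1"] p(2)[of "i - 2"] by simp_all
  have inc2: "p (i - 2) + 4 * p (i - 1) - 5 * p i \<le> 6 * h" "\<bar>2 * (p i - p (i - 1))\<bar> \<le> 2 * h" for i
    using inc[of i] by (simp_all add: abs_le_iff)
  have diag: "?S (\<lambda>i. (p (i - 2) + 4 * p (i - 1) - 5 * p i) * (u i)\<^sup>2) \<le> ?S (\<lambda>i. (6 * h) * (u i)\<^sup>2)"
    by (intro sum_mono mult_right_mono) (use inc2 in auto)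
  have off: "?S (\<lambda>i. (2 * (p i - p (i - 1))) * (u i * u (i + 1))) \<le> (2 * h) * ?S (\<lambda>i. (u i)\<^sup>2)"
    by (rule sum_adjacent_products_le[OF u0], assumption) (rule inc2)
  have diag': "?S (\<lambda>i. (p (i - 2) + 4 * p (i - 1) - 5 * p i) * (u i)\<^sup>2) = ?S (\<lambda>i. p (i - 2) * (u i)\<^sup>2)
      + 4 * ?S (\<lambda>i. p (i - 1) * (u i)\<^sup>2) - 5 * ?S (\<lambda>i. p i * (u i)\<^sup>2)"
    unfolding sum_distrib_left sum.distrib[symmetric] sum_subtractf[symmetric]
    by (rule sum.cong) (auto simp: algebra_simps)
  have off': "?S (\<lambda>i. (2 * (p i - p (i - 1))) * (u i * u (i + 1)))
      = 2 * ?S (\<lambda>i. p i * u i * u (i + 1)) - 2 * ?S (\<lambda>i. p (i - 1) * u i * u (i + 1))"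
    unfolding sum_distrib_left sum.distrib[symmetric] sum_subtractf[symmetric]
    by (rule sum.cong) (auto simp: algebra_simps)
  \<comment> \<open>Eliminating the sum of \<open>p i * u i * u (i + 2)\<close> between
    \<open>sq\<close> and \<open>P\<close> bounds twice the left-hand side by the sum in
    \<open>diag\<close> plus twice the sum in \<open>off\<close>, hence by
    \<open>6 * h + 2 * (2 * h)\<close> times the sum of squares. Half of this is the constant
    5.\<close>
  show ?thesis
    using sq diag off unfolding P diag' off' sum_distrib_left[symmetric] by linarith
qed

text \<open>The reflection of \<open>i\<close> to \<open>m - i\<close> exchanges forward and
  backward stencils and turns a nondecreasing weight into a nonincreasing one.\<close>

lemma sum_one_sided_reflected_le:
  fixes u p :: "int \<Rightarrow> real"
  assumes u0: "\<And>i. i \<notin> {0..m} \<Longrightarrow> u i = 0" and p0: "\<And>i. 0 \<le> p i"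
    and p: "\<And>i. p i \<le> p (i + 1)" "\<And>i. p (i + 1) \<le> p i + h"
  shows "(\<Sum>i = 0..m. p i * u i * (- u (i - 2) + 4 * u (i - 1) - 3 * u i))
    \<le> 5 * h * (\<Sum>i = 0..m. (u i)\<^sup>2)"
proof -
  have "(\<Sum>i = 0..m. p (m - i) * u (m - i) * (- u (m - (i + 2)) + 4 * u (m - (i + 1)) - 3 * u (m - i)))
    \<le> 5 * h * (\<Sum>i = 0..m. (u (m - i))\<^sup>2)"
  proof (rule sum_one_sided_le)
    show "p (m - (i + 1)) \<le> p (m - i)" "p (m - i) \<le> p (m - (i + 1)) + h" for i
      using p[of "m - (i + 1)"] by simp_all
  qed (use u0 p0 in auto)
  moreover have "(\<Sum>i = 0..m. (u (m - i))\<^sup>2) = (\<Sum>i = 0..m. (u i)\<^sup>2)"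
    by (rule sum.reindex_bij_witness[of _ "\<lambda>i. m - i" "\<lambda>i. m - i"]) auto
  moreover have "(\<Sum>i = 0..m. p (m - i) * u (m - i) * (- u (m - (i + 2)) + 4 * u (m - (i + 1)) - 3 * u (m - i)))
      = (\<Sum>i = 0..m. p i * u i * (- u (i - 2) + 4 * u (i - 1) - 3 * u i))"
    by (rule sum.reindex_bij_witness[of _ "\<lambda>i. m - i" "\<lambda>i. m - i"]) (auto simp: algebra_simps)
  ultimately show ?thesis by simp
qed

lemma upwind_weights:
  fixes w :: "int \<Rightarrow> real"
  assumes "(\<Sum>k = -1..2. w k) = 0" and "(\<Sum>k = -1..2. (of_int k)\<^sup>2 * w k) = 0"
  shows "w 1 = - w (-1) - 4 * w 2" and "w 0 = 3 * w 2"
proof -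
  have "{-1..2} = {-1, 0, 1, 2::int}" by auto
  then show "w 1 = - w (-1) - 4 * w 2" "w 0 = 3 * w 2" using assms by simp_all
qed

text \<open>Both stencils contain the same central part
  \<open>- w (-1) * (u (i + 1) - u (i - 1))\<close>, whose coefficient is the whole of
  \<open>a\<close>. The remainders carry the weights \<open>p\<close> and \<open>n\<close>, the
  positive part of \<open>a\<close> and the absolute value of its negative part; these are monotone
  in opposite directions with increments at most \<open>h\<close>. As \<open>- w 2\<close> is
  nonnegative, each remainder costs \<open>-5 * w 2 * h\<close>, together
  \<open>-10 * w 2 * h\<close>.\<close>

lemma sum_upwind_le:
  fixes u a w :: "int \<Rightarrow> real"
  assumes u0: "\<And>i. i \<notin> {0..m} \<Longrightarrow> u i = 0" and a: "\<And>i. a (i + 1) = a i - h" and h: "0 \<le> h"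
    and w1: "w 1 = - w (-1) - 4 * w 2" and w0: "w 0 = 3 * w 2" and w2: "w 2 \<le> 0"
  shows "(\<Sum>i = 0..m. u i * (pos_part (a i) * upwind_forward w u i + neg_part (a i) * upwind_backward w u i))
    \<le> (\<bar>w (-1)\<bar> - 10 * w 2) * h * (\<Sum>i = 0..m. (u i)\<^sup>2)"
proof -
  define p n where "p i = pos_part (a i)" and "n i = - neg_part (a i)" for i
  have apn: "a i = p i - n i" for i by (simp add: p_def n_def max_def min_def)
  have "(\<Sum>i = 0..m. u i * (pos_part (a i) * upwind_forward w u i + neg_part (a i) * upwind_backward w u i))
    = (\<Sum>i = 0..m. a i * u i * (- w (-1) * (u (i + 1) - u (i - 1))))
      - w 2 * (\<Sum>i = 0..m. p i * u i * (- u (i + 2) + 4 * u (i + 1) - 3 * u i))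
      - w 2 * (\<Sum>i = 0..m. n i * u i * (- u (i - 2) + 4 * u (i - 1) - 3 * u i))"
    unfolding sum_distrib_left sum.distrib[symmetric] sum_subtractf[symmetric]
  proof (rule sum.cong)
    fix i
    have e: "pos_part (a i) = p i" "neg_part (a i) = - n i" by (simp_all add: p_def n_def)
    show "u i * (pos_part (a i) * upwind_forward w u i + neg_part (a i) * upwind_backward w u i)
      = a i * u i * (- w (-1) * (u (i + 1) - u (i - 1)))
      - w 2 * (p i * u i * (- u (i + 2) + 4 * u (i + 1) - 3 * u i))
      - w 2 * (n i * u i * (- u (i - 2) + 4 * u (i - 1) - 3 * u i))"
      unfolding e upwind_forward_def upwind_backward_def w0 w1 unfolding apn by (simp add: algebra_simps)
  qed simp
  also have "\<dots> \<le> \<bar>- w (-1)\<bar> * h * (\<Sum>i = 0..m. (u i)\<^sup>2)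
      - w 2 * (5 * h * (\<Sum>i = 0..m. (u i)\<^sup>2)) - w 2 * (5 * h * (\<Sum>i = 0..m. (u i)\<^sup>2))"
  proof -
    have "(\<Sum>i = 0..m. a i * u i * (- w (-1) * (u (i + 1) - u (i - 1)))) \<le> \<bar>- w (-1)\<bar> * h * (\<Sum>i = 0..m. (u i)\<^sup>2)"
      by (rule sum_central_advection_le) (use u0 a h in auto)
    moreover have "(\<Sum>i = 0..m. p i * u i * (- u (i + 2) + 4 * u (i + 1) - 3 * u i)) \<le> 5 * h * (\<Sum>i = 0..m. (u i)\<^sup>2)"
      by (rule sum_one_sided_le) (use u0 h in \<open>auto simp: a p_def\<close>)
    moreover have "(\<Sum>i = 0..m. n i * u i * (- u (i - 2) + 4 * u (i - 1) - 3 * u i)) \<le> 5 * h * (\<Sum>i = 0..m. (u i)\<^sup>2)"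
      by (rule sum_one_sided_reflected_le) (use u0 h in \<open>auto simp: a n_def min_def\<close>)
    ultimately show ?thesis
      using w2 by (intro diff_mono; simp add: mult_left_mono_neg)
  qed
  also have "\<dots> = (\<bar>w (-1)\<bar> - 10 * w 2) * h * (\<Sum>i = 0..m. (u i)\<^sup>2)"
    by (simp add: algebra_simps)
  finally show ?thesis .
qed

section \<open>Stability function of a dissipative matrix\<close>

lemma smult_mat_mult_vec:
  fixes A :: "real mat"
  assumes "A \<in> carrier_mat N N" "v \<in> carrier_vec N"
  shows "(t \<cdot>\<^sub>m A) *\<^sub>v v = t \<cdot>\<^sub>v (A *\<^sub>v v)"
  using assms by (intro eq_vecI) auto

lemma scalar_prod_self_nonneg: "0 \<le> scalar_prod v (v :: real vec)"
  unfolding scalar_prod_def by (intro sum_nonneg) auto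

lemma scalar_prod_self_eq_0:
  assumes "v \<in> carrier_vec N" and "scalar_prod v v = (0 :: real)"
  shows "v = 0\<^sub>v N"
proof -
  have "\<forall>i\<in>{0..<N}. v $ i * v $ i = 0"
    using assms by (intro iffD1[OF sum_nonneg_eq_0_iff]) (auto simp: scalar_prod_def)
  then show ?thesis using assms by (intro eq_vecI) auto
qed

lemma scalar_prod_add_scaled_le:
  fixes u v :: "real vec"
  assumes "u \<in> carrier_vec N" "v \<in> carrier_vec N"
  shows "scalar_prod (u + t \<cdot>\<^sub>v v) (u + t \<cdot>\<^sub>v v) \<le> 2 * scalar_prod u u + 2 * t\<^sup>2 * scalar_prod v v"
proof -
  have "scalar_prod (u + t \<cdot>\<^sub>v v) (u + t \<cdot>\<^sub>v v) = (\<Sum>i = 0..<N. (u $ i + t * v $ i) * (u $ i + t * v $ i))"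
    using assms by (simp add: scalar_prod_def)
  also have "\<dots> \<le> (\<Sum>i = 0..<N. 2 * (u $ i * u $ i) + 2 * t\<^sup>2 * (v $ i * v $ i))"
  proof (rule sum_mono)
    fix i
    show "(u $ i + t * v $ i) * (u $ i + t * v $ i) \<le> 2 * (u $ i * u $ i) + 2 * t\<^sup>2 * (v $ i * v $ i)"
      using zero_le_power2[of "u $ i - t * v $ i"] by (simp add: power2_eq_square algebra_simps)
  qed
  also have "\<dots> = 2 * scalar_prod u u + 2 * t\<^sup>2 * scalar_prod v v"
    using assms by (simp add: scalar_prod_def sum.distrib sum_distrib_left)
  finally show ?thesis .
qed

text \<open>With \<open>y = W x\<close>, expanding the square of
  \<open>(x - \<theta> y) - k x\<close> gives a lower bound for the squared norm of
  \<open>x - \<theta> y\<close> in terms of its product with \<open>x\<close>. That product is at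
  least \<open>k\<close> times the squared norm of \<open>x\<close> by dissipativity. Only squares
  occur, so no norm has to be divided out.\<close>

lemma resolvent_bound:
  fixes W :: "real mat"
  assumes W: "W \<in> carrier_mat N N" and x: "x \<in> carrier_vec N"
    and diss: "scalar_prod x (W *\<^sub>v x) \<le> c * scalar_prod x x"
    and \<theta>: "0 \<le> \<theta>" and k: "0 \<le> k" "k \<le> 1 - \<theta> * c"
  shows "k\<^sup>2 * scalar_prod x x \<le> scalar_prod (x - \<theta> \<cdot>\<^sub>v (W *\<^sub>v x)) (x - \<theta> \<cdot>\<^sub>v (W *\<^sub>v x))"
proof -
  define y where "y = W *\<^sub>v x"
  have y: "y \<in> carrier_vec N" using W x by (simp add: y_def)
  have "0 \<le> (\<Sum>i = 0..<N. ((x $ i - \<theta> * y $ i) - k * x $ i)\<^sup>2)"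
    by (intro sum_nonneg) auto
  also have "\<dots> = scalar_prod (x - \<theta> \<cdot>\<^sub>v y) (x - \<theta> \<cdot>\<^sub>v y) - 2 * k * (scalar_prod x x - \<theta> * scalar_prod x y) + k\<^sup>2 * scalar_prod x x"
  proof -
    have "(\<Sum>i = 0..<N. ((x $ i - \<theta> * y $ i) - k * x $ i)\<^sup>2)
      = (\<Sum>i = 0..<N. (x $ i - \<theta> * y $ i) * (x $ i - \<theta> * y $ i)
        - 2 * k * (x $ i * x $ i - \<theta> * (x $ i * y $ i)) + k\<^sup>2 * (x $ i * x $ i))"
      by (rule sum.cong) (auto simp: power2_eq_square algebra_simps)
    also have "\<dots> = (\<Sum>i = 0..<N. (x $ i - \<theta> * y $ i) * (x $ i - \<theta> * y $ i))
        - 2 * k * ((\<Sum>i = 0..<N. x $ i * x $ i) - \<theta> * (\<Sum>i = 0..<N. x $ i * y $ i))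
        + k\<^sup>2 * (\<Sum>i = 0..<N. x $ i * x $ i)"
      by (simp only: sum_distrib_left sum_subtractf[symmetric] sum.distrib[symmetric])
    finally show ?thesis using x y by (simp add: scalar_prod_def)
  qed
  finally have 1: "2 * k * (scalar_prod x x - \<theta> * scalar_prod x y) - k\<^sup>2 * scalar_prod x x
    \<le> scalar_prod (x - \<theta> \<cdot>\<^sub>v y) (x - \<theta> \<cdot>\<^sub>v y)" by simp
  have "\<theta> * scalar_prod x y \<le> \<theta> * (c * scalar_prod x x)"
    by (rule mult_left_mono) (use diss \<theta> y_def in auto)
  moreover have "k * scalar_prod x x \<le> (1 - \<theta> * c) * scalar_prod x x"
    by (rule mult_right_mono) (use k scalar_prod_self_nonneg in auto)
  ultimately have "k * scalar_prod x x \<le> scalar_prod x x - \<theta> * scalar_prod x y"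
    by (simp add: algebra_simps)
  then have "2 * k * (k * scalar_prod x x) \<le> 2 * k * (scalar_prod x x - \<theta> * scalar_prod x y)"
    by (rule mult_left_mono) (use k in auto)
  then have "k\<^sup>2 * scalar_prod x x \<le> scalar_prod (x - \<theta> \<cdot>\<^sub>v y) (x - \<theta> \<cdot>\<^sub>v y)"
    using 1 by (simp add: power2_eq_square algebra_simps)
  then show ?thesis by (simp add: y_def)
qed

section \<open>Energy estimate for one DIRK step\<close>

definition dirk_numerator :: "real \<Rightarrow> real mat \<Rightarrow> real vec \<Rightarrow> real vec" where
  "dirk_numerator \<theta> W u = u + (1 - 2 * \<theta>) \<cdot>\<^sub>v (W *\<^sub>v u) + (1 / 2 - 2 * \<theta> + \<theta>\<^sup>2) \<cdot>\<^sub>v (W *\<^sub>v (W *\<^sub>v u))"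

text \<open>The factor \<open>I - \<theta> W\<close> as a map on vectors. Writing \<open>v\<close>
  as two stages applied to \<open>u\<close> lets the energy estimate be stated without any
  inverse.\<close>

definition dirk_stage :: "real \<Rightarrow> real mat \<Rightarrow> real vec \<Rightarrow> real vec" where
  "dirk_stage \<theta> W u = u - \<theta> \<cdot>\<^sub>v (W *\<^sub>v u)"

lemma dirk_numerator_carrier [simp]:
  "W \<in> carrier_mat N N \<Longrightarrow> u \<in> carrier_vec N \<Longrightarrow> dirk_numerator \<theta> W u \<in> carrier_vec N"
  by (simp add: dirk_numerator_def)

lemma dirk_stage_carrier [simp]:
  "W \<in> carrier_mat N N \<Longrightarrow> u \<in> carrier_vec N \<Longrightarrow> dirk_stage \<theta> W u \<in> carrier_vec N"
  by (simp add: dirk_stage_def)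

text \<open>Only \<open>u\<close>, \<open>q = W u\<close> and \<open>s = W q\<close> occur, so this
  is an identity between quadratic forms in three vectors and can be checked coordinate by
  coordinate. The shift \<open>(4 * \<theta> - 1) / 2\<close> in \<open>x\<close> is the one that
  reproduces the coefficient \<open>4 * \<theta> - 1\<close> of both \<open>u s\<close> and
  \<open>q q\<close>.\<close>

lemma dirk_energy_identity:
  fixes W :: "real mat" and \<theta> :: real
  assumes W: "W \<in> carrier_mat N N" and u: "u \<in> carrier_vec N"
  defines "q \<equiv> W *\<^sub>v u"
  defines "v \<equiv> dirk_stage \<theta> W (dirk_stage \<theta> W u)"
    and "x \<equiv> u - ((4 * \<theta> - 1) / 2) \<cdot>\<^sub>v q"
  shows "scalar_prod v v - scalar_prod (dirk_numerator \<theta> W u) (dirk_numerator \<theta> W u)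
    = (4 * \<theta> - 1) * (1 - 2 * \<theta>)\<^sup>2 / 4 * scalar_prod (W *\<^sub>v q) (W *\<^sub>v q)
      - 2 * scalar_prod x (W *\<^sub>v x) - (1 - 2 * \<theta>)\<^sup>2 / 2 * scalar_prod q (W *\<^sub>v q)"
proof -
  define s where "s = W *\<^sub>v q"
  have c: "q \<in> carrier_vec N" "s \<in> carrier_vec N" using W u by (auto simp: q_def s_def)
  have Wx: "W *\<^sub>v x = q - ((4 * \<theta> - 1) / 2) \<cdot>\<^sub>v s"
    using W u c by (simp add: x_def q_def s_def mult_minus_distrib_mat_vec mult_mat_vec)
  have Wd: "W *\<^sub>v dirk_stage \<theta> W u = q - \<theta> \<cdot>\<^sub>v s"
    using W u c unfolding dirk_stage_def q_def[symmetric]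
    by (subst mult_minus_distrib_mat_vec[of _ N N]) (auto simp: q_def s_def mult_mat_vec)
  have v: "v = (u - \<theta> \<cdot>\<^sub>v q) - \<theta> \<cdot>\<^sub>v (q - \<theta> \<cdot>\<^sub>v s)"
    unfolding v_def dirk_stage_def[of \<theta> W "dirk_stage \<theta> W u"] Wd by (simp add: dirk_stage_def q_def)
  have n: "dirk_numerator \<theta> W u = u + (1 - 2 * \<theta>) \<cdot>\<^sub>v q + (1 / 2 - 2 * \<theta> + \<theta>\<^sup>2) \<cdot>\<^sub>v s"
    by (simp add: dirk_numerator_def q_def s_def)
  have x: "x \<in> carrier_vec N" using u c by (simp add: x_def)
  have sp: "scalar_prod y z = (\<Sum>i = 0..<N. y $ i * z $ i)" if "z \<in> carrier_vec N" for y z :: "real vec"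
    using that by (simp add: scalar_prod_def)
  have pointwise: "(U - \<theta> * Q - \<theta> * (Q - \<theta> * S)) * (U - \<theta> * Q - \<theta> * (Q - \<theta> * S))
      - (U + (1 - 2 * \<theta>) * Q + (1 / 2 - 2 * \<theta> + \<theta>\<^sup>2) * S) * (U + (1 - 2 * \<theta>) * Q + (1 / 2 - 2 * \<theta> + \<theta>\<^sup>2) * S)
    = (4 * \<theta> - 1) * (1 - 2 * \<theta>)\<^sup>2 / 4 * (S * S)
      - 2 * ((U - (4 * \<theta> - 1) / 2 * Q) * (Q - (4 * \<theta> - 1) / 2 * S)) - (1 - 2 * \<theta>)\<^sup>2 / 2 * (Q * S)" for U Q S :: real
    by (simp add: field_simps power2_eq_square)
  have "scalar_prod v v - scalar_prod (dirk_numerator \<theta> W u) (dirk_numerator \<theta> W u)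
    = (\<Sum>i = 0..<N. v $ i * v $ i - dirk_numerator \<theta> W u $ i * dirk_numerator \<theta> W u $ i)"
    using u c by (simp add: sp v n sum_subtractf)
  also have "\<dots> = (\<Sum>i = 0..<N. (4 * \<theta> - 1) * (1 - 2 * \<theta>)\<^sup>2 / 4 * (s $ i * s $ i)
      - 2 * (x $ i * (W *\<^sub>v x) $ i) - (1 - 2 * \<theta>)\<^sup>2 / 2 * (q $ i * s $ i))"
  proof (rule sum.cong)
    fix i assume "i \<in> {0..<N}"
    then show "v $ i * v $ i - dirk_numerator \<theta> W u $ i * dirk_numerator \<theta> W u $ i
      = (4 * \<theta> - 1) * (1 - 2 * \<theta>)\<^sup>2 / 4 * (s $ i * s $ i)
      - 2 * (x $ i * (W *\<^sub>v x) $ i) - (1 - 2 * \<theta>)\<^sup>2 / 2 * (q $ i * s $ i)"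
      using pointwise[of "u $ i" "q $ i" "s $ i"] u c unfolding v n Wx unfolding x_def
      by (simp add: add.assoc)
  qed simp
  also have "\<dots> = (4 * \<theta> - 1) * (1 - 2 * \<theta>)\<^sup>2 / 4 * scalar_prod s s
      - 2 * scalar_prod x (W *\<^sub>v x) - (1 - 2 * \<theta>)\<^sup>2 / 2 * scalar_prod q s"
  proof -
    have "W *\<^sub>v x \<in> carrier_vec N" using W x by simp
    then show ?thesis
      unfolding sp[OF c(2)] by (simp only: sp sum_subtractf sum_distrib_left)
  qed
  finally show ?thesis by (simp add: s_def)
qed

text \<open>The squared term of the energy identity is dropped by its sign. Dissipativity bounds the
  other two by \<open>c\<close> times the squared norms of \<open>x\<close> and \<open>q\<close>,
  which have to be controlled by \<open>v\<close> alone with constants that do not involve the size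
  of \<open>W\<close>.\<close>

lemma dirk_step_bound:
  fixes W :: "real mat" and \<theta> :: real
  assumes W: "W \<in> carrier_mat N N" and u: "u \<in> carrier_vec N"
    and diss: "\<And>x. x \<in> carrier_vec N \<Longrightarrow> scalar_prod x (W *\<^sub>v x) \<le> c * scalar_prod x x"
    and c: "0 \<le> c" "c \<le> \<nu>" and \<theta>: "1 / 4 \<le> \<theta>" "\<theta> \<le> 1 / 2" and \<nu>: "\<nu> < 1 / \<theta>"
  defines "v \<equiv> dirk_stage \<theta> W (dirk_stage \<theta> W u)"
  shows "scalar_prod (dirk_numerator \<theta> W u) (dirk_numerator \<theta> W u)
    \<le> (1 + 76 / (1 - \<theta> * \<nu>) ^ 4 * c) * scalar_prod v v"
proof -
  define k where "k = 1 - \<theta> * \<nu>"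
  define K where "K = 1 / k\<^sup>2"
  have k: "0 < k" "k \<le> 1 - \<theta> * c"
    using \<nu> \<theta> c by (auto simp: k_def field_simps)
  have "k \<le> 1" using c \<theta> by (auto simp: k_def)
  then have K: "0 < K" "1 \<le> K" using k by (auto simp: K_def power_le_one)
  have K2: "K \<le> K\<^sup>2" using K by (simp add: power2_eq_square)
  define z where "z = dirk_stage \<theta> W u"
  define q where "q = W *\<^sub>v u"
  define x where "x = u - ((4 * \<theta> - 1) / 2) \<cdot>\<^sub>v q"
  have car: "z \<in> carrier_vec N" "q \<in> carrier_vec N" "x \<in> carrier_vec N" "v \<in> carrier_vec N"
    using W u by (auto simp: z_def q_def x_def v_def)
  have res: "scalar_prod y y \<le> K * scalar_prod (dirk_stage \<theta> W y) (dirk_stage \<theta> W y)"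
    if y: "y \<in> carrier_vec N" for y
    using resolvent_bound[OF W y diss[OF y], of \<theta> k] k \<theta> y
    by (simp add: K_def dirk_stage_def field_simps)
  have bz: "scalar_prod z z \<le> K * scalar_prod v v"
    using res[OF car(1)] by (simp add: z_def v_def)
  have "scalar_prod u u \<le> K * scalar_prod z z" using res[OF u] by (simp add: z_def)
  also have "\<dots> \<le> K * (K * scalar_prod v v)" using bz K by simp
  finally have bu: "scalar_prod u u \<le> K\<^sup>2 * scalar_prod v v" by (simp add: power2_eq_square)
  have "K * scalar_prod v v \<le> K\<^sup>2 * scalar_prod v v"
    by (rule mult_right_mono[OF K2 scalar_prod_self_nonneg])
  with bz have bz': "scalar_prod z z \<le> K\<^sup>2 * scalar_prod v v" by linarith
  \<comment> \<open>This is where \<open>W u\<close> is bounded without a norm of \<open>W\<close>,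
    which would blow up under mesh refinement: \<open>\<theta> q\<close> is the difference of
    \<open>u\<close> and the stage \<open>z\<close>, both already controlled by
    \<open>v\<close>.\<close>
  have q_eq: "\<theta> \<cdot>\<^sub>v q = u + (-1) \<cdot>\<^sub>v z"
    using u car W by (intro eq_vecI) (auto simp: z_def dirk_stage_def q_def)
  have "\<theta>\<^sup>2 * scalar_prod q q = scalar_prod (\<theta> \<cdot>\<^sub>v q) (\<theta> \<cdot>\<^sub>v q)"
    using car by (simp add: power2_eq_square)
  also have "\<dots> \<le> 2 * scalar_prod u u + 2 * scalar_prod z z"
    unfolding q_eq using scalar_prod_add_scaled_le[OF u car(1), of "-1"] by simp
  finally have q1: "\<theta>\<^sup>2 * scalar_prod q q \<le> 4 * (K\<^sup>2 * scalar_prod v v)" using bu bz' by linarith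
  \<comment> \<open>Dividing by \<open>\<theta>\<^sup>2\<close>, which is at least 1/16, turns the 4
    of \<open>q1\<close> into 64.\<close>
  have "(1 / 4)\<^sup>2 \<le> \<theta>\<^sup>2" using \<theta> by (intro power_mono) auto
  then have "(1 / 4)\<^sup>2 * scalar_prod q q \<le> \<theta>\<^sup>2 * scalar_prod q q"
    by (intro mult_right_mono scalar_prod_self_nonneg)
  with q1 have bq: "scalar_prod q q \<le> 64 * (K\<^sup>2 * scalar_prod v v)"
    by (simp add: power2_eq_square)
  have x_eq: "x = u + (- ((4 * \<theta> - 1) / 2)) \<cdot>\<^sub>v q"
    using u car by (intro eq_vecI) (auto simp: x_def)
  have "((4 * \<theta> - 1) / 2)\<^sup>2 \<le> (1 / 2)\<^sup>2" using \<theta> by (intro power_mono) auto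
  then have "2 * (- ((4 * \<theta> - 1) / 2))\<^sup>2 * scalar_prod q q \<le> 1 / 2 * scalar_prod q q"
    by (intro mult_right_mono scalar_prod_self_nonneg) (simp add: power2_eq_square)
  \<comment> \<open>The constant is 2 from \<open>u\<close> plus 64 / 2 from
    \<open>q\<close>.\<close>
  then have bx: "scalar_prod x x \<le> 34 * (K\<^sup>2 * scalar_prod v v)"
    using scalar_prod_add_scaled_le[OF u car(2), of "- ((4 * \<theta> - 1) / 2)"] bu bq
    unfolding x_eq[symmetric] by linarith
  have "scalar_prod v v - scalar_prod (dirk_numerator \<theta> W u) (dirk_numerator \<theta> W u)
    = (4 * \<theta> - 1) * (1 - 2 * \<theta>)\<^sup>2 / 4 * scalar_prod (W *\<^sub>v q) (W *\<^sub>v q)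
      - 2 * scalar_prod x (W *\<^sub>v x) - (1 - 2 * \<theta>)\<^sup>2 / 2 * scalar_prod q (W *\<^sub>v q)"
    unfolding v_def x_def q_def by (rule dirk_energy_identity[OF W u])
  moreover have "0 \<le> (4 * \<theta> - 1) * (1 - 2 * \<theta>)\<^sup>2 / 4 * scalar_prod (W *\<^sub>v q) (W *\<^sub>v q)"
    using \<theta> scalar_prod_self_nonneg by (intro mult_nonneg_nonneg) auto
  moreover have "scalar_prod x (W *\<^sub>v x) \<le> c * (34 * (K\<^sup>2 * scalar_prod v v))"
    using diss[OF car(3)] mult_left_mono[OF bx c(1)] by linarith
  moreover have "(1 - 2 * \<theta>)\<^sup>2 / 2 * scalar_prod q (W *\<^sub>v q) \<le> 1 / 8 * (c * (64 * (K\<^sup>2 * scalar_prod v v)))"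
  proof -
    have "scalar_prod q (W *\<^sub>v q) \<le> c * (64 * (K\<^sup>2 * scalar_prod v v))"
      using diss[OF car(2)] mult_left_mono[OF bq c(1)] by linarith
    then have "(1 - 2 * \<theta>)\<^sup>2 / 2 * scalar_prod q (W *\<^sub>v q) \<le> (1 - 2 * \<theta>)\<^sup>2 / 2 * (c * (64 * (K\<^sup>2 * scalar_prod v v)))"
      by (rule mult_left_mono) auto
    also have "\<dots> \<le> 1 / 8 * (c * (64 * (K\<^sup>2 * scalar_prod v v)))"
    proof (rule mult_right_mono)
      have "(1 - 2 * \<theta>)\<^sup>2 \<le> (1 / 2)\<^sup>2" using \<theta> by (intro power_mono) auto
      then show "(1 - 2 * \<theta>)\<^sup>2 / 2 \<le> 1 / 8" by (simp add: power2_eq_square)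
      show "0 \<le> c * (64 * (K\<^sup>2 * scalar_prod v v))"
        using c scalar_prod_self_nonneg by (intro mult_nonneg_nonneg) auto
    qed
    finally show ?thesis .
  qed
  \<comment> \<open>The constant is \<open>2 * 34\<close> from \<open>x\<close> plus
    \<open>64 / 8\<close> from \<open>q\<close>; the factor \<open>K\<^sup>2\<close> is the fourth
    power of \<open>1 / (1 - \<theta> * \<nu>)\<close>.\<close>
  ultimately have "scalar_prod (dirk_numerator \<theta> W u) (dirk_numerator \<theta> W u)
    \<le> scalar_prod v v + 76 * (c * (K\<^sup>2 * scalar_prod v v))"
    by linarith
  also have "\<dots> = (1 + 76 / (1 - \<theta> * \<nu>) ^ 4 * c) * scalar_prod v v"
    by (simp add: K_def k_def power_divide algebra_simps flip: power_mult)
  finally show ?thesis .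
qed

text \<open>The inverse \<open>P\<close> commutes with \<open>W\<close> and hence with the
  numerator. So the stability function applied to \<open>v\<close> is the numerator at
  \<open>u = P (P v)\<close>, and two stages lead from \<open>u\<close> back to
  \<open>v\<close>.\<close>

lemma dirk_R_apply:
  fixes W P :: "real mat"
  assumes W: "W \<in> carrier_mat N N" and P: "P \<in> carrier_mat N N" and v: "v \<in> carrier_vec N"
    and inv: "mat_inverse (1\<^sub>m N - \<theta> \<cdot>\<^sub>m W) = Some P" and \<theta>: "\<theta> \<noteq> 0"
  shows "dirk_R \<theta> W *\<^sub>v v = dirk_numerator \<theta> W (P *\<^sub>v (P *\<^sub>v v))"
    and "dirk_stage \<theta> W (P *\<^sub>v v) = v"
proof -
  let ?E = "1\<^sub>m N - \<theta> \<cdot>\<^sub>m W"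
  have E: "?E \<in> carrier_mat N N" using W by auto
  have P1: "?E * P = 1\<^sub>m N" "P * ?E = 1\<^sub>m N" using mat_inverse(2)[OF E inv] by auto
  have Ev: "?E *\<^sub>v z = z - \<theta> \<cdot>\<^sub>v (W *\<^sub>v z)" if "z \<in> carrier_vec N" for z
    using W that by (subst minus_mult_distrib_mat_vec[of _ N N]) (auto simp: smult_mat_mult_vec[of _ N])
  have EP: "?E *\<^sub>v (P *\<^sub>v z) = z" and PE: "P *\<^sub>v (?E *\<^sub>v z) = z" if z: "z \<in> carrier_vec N" for z
    using assoc_mult_mat_vec[OF E P z] assoc_mult_mat_vec[OF P E z] P1 z by simp_all
  show "dirk_stage \<theta> W (P *\<^sub>v v) = v"
    using EP[OF v] Ev[of "P *\<^sub>v v"] P v by (simp add: dirk_stage_def)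
  \<comment> \<open>\<open>P\<close> commutes with \<open>I - \<theta> W\<close>; comparing
    coordinates and cancelling the nonzero \<open>\<theta>\<close> leaves commutation with
    \<open>W\<close>.\<close>
  have comm: "P *\<^sub>v (W *\<^sub>v z) = W *\<^sub>v (P *\<^sub>v z)" if z: "z \<in> carrier_vec N" for z
  proof -
    have Wz: "W *\<^sub>v z \<in> carrier_vec N" and Pz: "P *\<^sub>v z \<in> carrier_vec N" using W P z by auto
    have "P *\<^sub>v z - \<theta> \<cdot>\<^sub>v (P *\<^sub>v (W *\<^sub>v z)) = P *\<^sub>v (?E *\<^sub>v z)"
      unfolding Ev[OF z] using P z Wz
      by (subst mult_minus_distrib_mat_vec[of _ N N]) (auto simp: mult_mat_vec)
    also have "\<dots> = ?E *\<^sub>v (P *\<^sub>v z)" using EP[OF z] PE[OF z] by simp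
    also have "\<dots> = P *\<^sub>v z - \<theta> \<cdot>\<^sub>v (W *\<^sub>v (P *\<^sub>v z))" by (rule Ev[OF Pz])
    finally have eq: "P *\<^sub>v z - \<theta> \<cdot>\<^sub>v (P *\<^sub>v (W *\<^sub>v z)) = P *\<^sub>v z - \<theta> \<cdot>\<^sub>v (W *\<^sub>v (P *\<^sub>v z))" .
    show ?thesis
    proof (rule eq_vecI)
      fix i assume "i < dim_vec (W *\<^sub>v (P *\<^sub>v z))"
      then have i: "i < N" using W by simp
      have "(P *\<^sub>v z - \<theta> \<cdot>\<^sub>v (P *\<^sub>v (W *\<^sub>v z))) $ i = (P *\<^sub>v z - \<theta> \<cdot>\<^sub>v (W *\<^sub>v (P *\<^sub>v z))) $ i"
        using eq by simp
      then show "(P *\<^sub>v (W *\<^sub>v z)) $ i = (W *\<^sub>v (P *\<^sub>v z)) $ i"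
        using i W P \<theta> by (simp del: index_mult_mat_vec)
    qed (use W P in auto)
  qed
  have PN: "P *\<^sub>v dirk_numerator \<theta> W z = dirk_numerator \<theta> W (P *\<^sub>v z)" if z: "z \<in> carrier_vec N" for z
  proof -
    have Wz: "W *\<^sub>v z \<in> carrier_vec N" "W *\<^sub>v (W *\<^sub>v z) \<in> carrier_vec N" using W z by auto
    show ?thesis
      unfolding dirk_numerator_def using W P z Wz
      by (simp add: mult_add_distrib_mat_vec[of _ N N] mult_mat_vec comm assoc_add_vec[of _ N])
  qed
  let ?Q = "1\<^sub>m N + (1 - 2 * \<theta>) \<cdot>\<^sub>m W + (1 / 2 - 2 * \<theta> + \<theta>\<^sup>2) \<cdot>\<^sub>m (W ^\<^sub>m 2)"
  have W2: "W ^\<^sub>m 2 = W * W" and P2: "P ^\<^sub>m 2 = P * P" using W P by (simp_all add: numeral_2_eq_2)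
  have Q: "?Q *\<^sub>v v = dirk_numerator \<theta> W v"
    unfolding dirk_numerator_def W2 using W v
    by (simp add: add_mult_distrib_mat_vec[of _ N N] smult_mat_mult_vec[of _ N]
        assoc_mult_mat_vec[of _ N N])
  have Qc: "?Q \<in> carrier_mat N N" using W by (auto simp: W2)
  have "dirk_R \<theta> W *\<^sub>v v = P * P * ?Q *\<^sub>v v"
    using W inv by (simp add: dirk_R_def Let_def P2)
  also have "\<dots> = P *\<^sub>v (P *\<^sub>v (?Q *\<^sub>v v))"
    using P Qc v by (simp add: assoc_mult_mat_vec[of _ N N _ N])
  also have "\<dots> = dirk_numerator \<theta> W (P *\<^sub>v (P *\<^sub>v v))"
    unfolding Q using P W v by (simp add: PN)
  finally show "dirk_R \<theta> W *\<^sub>v v = dirk_numerator \<theta> W (P *\<^sub>v (P *\<^sub>v v))" .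
qed

lemma dirk_R_stable:
  fixes W :: "real mat"
  assumes W: "W \<in> carrier_mat N N"
    and diss: "\<And>x. x \<in> carrier_vec N \<Longrightarrow> scalar_prod x (W *\<^sub>v x) \<le> c * scalar_prod x x"
    and c: "0 \<le> c" "c \<le> \<nu>" and \<theta>: "1 / 4 \<le> \<theta>" "\<theta> \<le> 1 / 2" and \<nu>: "\<nu> < 1 / \<theta>"
  shows "invertible_mat (1\<^sub>m N - \<theta> \<cdot>\<^sub>m W)" and "dirk_R \<theta> W \<in> carrier_mat N N"
    and "\<And>v. v \<in> carrier_vec N \<Longrightarrow> scalar_prod (dirk_R \<theta> W *\<^sub>v v) (dirk_R \<theta> W *\<^sub>v v)
      \<le> (1 + 76 / (1 - \<theta> * \<nu>) ^ 4 * c) * scalar_prod v v"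
proof -
  let ?E = "1\<^sub>m N - \<theta> \<cdot>\<^sub>m W"
  have E: "?E \<in> carrier_mat N N" using W by auto
  \<comment> \<open>A kernel vector of \<open>I - \<theta> W\<close> would violate the resolvent
    bound. With a nonzero determinant \<open>mat_inverse\<close> cannot return \<open>None\<close>,
    so \<open>the\<close> in \<open>dirk_R\<close> yields the true inverse.\<close>
  have "det ?E \<noteq> 0"
  proof
    assume "det ?E = 0"
    then obtain v where v: "v \<in> carrier_vec N" "v \<noteq> 0\<^sub>v N" "?E *\<^sub>v v = 0\<^sub>v N"
      using det_0_iff_vec_prod_zero_field[OF E] by auto
    have k: "0 < 1 - \<theta> * \<nu>" "1 - \<theta> * \<nu> \<le> 1 - \<theta> * c" using \<nu> \<theta> c by (auto simp: field_simps)
    have "v - \<theta> \<cdot>\<^sub>v (W *\<^sub>v v) = 0\<^sub>v N"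
      using v W by (subst v(3)[symmetric], subst minus_mult_distrib_mat_vec[of _ N N])
        (auto simp: smult_mat_mult_vec[of _ N])
    then have "(1 - \<theta> * \<nu>)\<^sup>2 * scalar_prod v v \<le> 0"
      using resolvent_bound[OF W v(1) diss[OF v(1)], of \<theta> "1 - \<theta> * \<nu>"] k \<theta> by simp
    then have "scalar_prod v v = 0"
      using k(1) scalar_prod_self_nonneg[of v] by (simp add: mult_le_0_iff)
    with v show False using scalar_prod_self_eq_0 by blast
  qed
  then obtain P where inv: "mat_inverse ?E = Some P"
    using mat_inverse(1)[OF E, of "()"] det_non_zero_imp_unit[OF E, of "()"] by (cases "mat_inverse ?E") auto
  have P: "P \<in> carrier_mat N N" "?E * P = 1\<^sub>m N" "P * ?E = 1\<^sub>m N"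
    using mat_inverse(2)[OF E inv] by auto
  show "invertible_mat ?E"
    using E P W unfolding invertible_mat_def inverts_mat_def by auto
  show "dirk_R \<theta> W \<in> carrier_mat N N"
    using W P inv by (auto simp: dirk_R_def Let_def)
  fix v :: "real vec" assume v: "v \<in> carrier_vec N"
  have "\<theta> \<noteq> 0" using \<theta> by auto
  note app = dirk_R_apply[OF W P(1) _ inv this]
  have Pv: "P *\<^sub>v v \<in> carrier_vec N" "P *\<^sub>v (P *\<^sub>v v) \<in> carrier_vec N" using P v by auto
  have "dirk_stage \<theta> W (dirk_stage \<theta> W (P *\<^sub>v (P *\<^sub>v v))) = v"
    using app(2)[OF v] app(2)[OF Pv(1)] by simp
  then show "scalar_prod (dirk_R \<theta> W *\<^sub>v v) (dirk_R \<theta> W *\<^sub>v v)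
      \<le> (1 + 76 / (1 - \<theta> * \<nu>) ^ 4 * c) * scalar_prod v v"
    using dirk_step_bound[OF W Pv(2) diss c \<theta> \<nu>] unfolding app(1)[OF v] by simp
qed

section \<open>The integral operator\<close>

lemma absolutely_integrable_linear_weight:
  fixes g :: "real \<Rightarrow> real"
  assumes "g absolutely_integrable_on {a..b}"
  shows "(\<lambda>x. (s * x + t) * g x) absolutely_integrable_on {a..b}"
proof (rule absolutely_integrable_bounded_measurable_product_real[OF _ _ _ assms])
  have c: "continuous_on {a..b} (\<lambda>x. s * x + t)" by (intro continuous_intros)
  show "(\<lambda>x. s * x + t) \<in> borel_measurable (lebesgue_on {a..b})"
    by (rule continuous_imp_measurable_on_sets_lebesgue[OF c]) simp
  show "bounded ((\<lambda>x. s * x + t) ` {a..b})"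
    by (intro compact_imp_bounded compact_continuous_image c) simp
qed simp

text \<open>The two linear factors form a partition of unity on the cell, so the weights add up to
  the mass of \<open>g\<close> there. Each factor has integral \<open>(b - a) / 2\<close>, whence
  the bound by \<open>F\<close>.\<close>

lemma hat_weights:
  fixes g :: "real \<Rightarrow> real"
  assumes g: "g absolutely_integrable_on {a..b}" and ab: "a < b"
    and g0: "\<And>x. 0 \<le> g x" and gF: "\<And>x. g x \<le> F"
  defines "p \<equiv> integral {a..b} (\<lambda>x. (b - x) / (b - a) * g x)"
    and "q \<equiv> integral {a..b} (\<lambda>x. (x - a) / (b - a) * g x)"
  shows "0 \<le> p" "p \<le> F * (b - a) / 2" "0 \<le> q" "q \<le> F * (b - a) / 2"
    and "p + q = integral {a..b} g"
    and "(LINT x:{a..b}|lebesgue. ((b - x) / (b - a) * A + (x - a) / (b - a) * B) * g x) = p * A + q * B"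
proof -
  have ip: "(\<lambda>x. (b - x) / (b - a) * g x) absolutely_integrable_on {a..b}"
    using absolutely_integrable_linear_weight[OF g, of "-1 / (b - a)" "b / (b - a)"]
    by (simp add: diff_divide_distrib)
  have iq: "(\<lambda>x. (x - a) / (b - a) * g x) absolutely_integrable_on {a..b}"
    using absolutely_integrable_linear_weight[OF g, of "1 / (b - a)" "- a / (b - a)"]
    by (simp add: diff_divide_distrib)
  note hp = set_lebesgue_integral_eq_integral(1)[OF ip] and hq = set_lebesgue_integral_eq_integral(1)[OF iq]
  have half: "((\<lambda>x. (b - x) / (b - a) * F) has_integral F * (b - a) / 2) {a..b}"
    "((\<lambda>x. (x - a) / (b - a) * F) has_integral F * (b - a) / 2) {a..b}"
  proof -
    define c where "c = F / (b - a)"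
    have c: "c * (b - a) = F" using ab by (simp add: c_def)
    have "((\<lambda>x. c * (b - x)) has_integral c * (b * b - b\<^sup>2 / 2) - c * (b * a - a\<^sup>2 / 2)) {a..b}"
      by (rule fundamental_theorem_of_calculus)
        (use ab in \<open>auto intro!: derivative_eq_intros simp flip: has_real_derivative_iff_has_vector_derivative\<close>)
    moreover have "c * (b * b - b\<^sup>2 / 2) - c * (b * a - a\<^sup>2 / 2) = F * (b - a) / 2"
      unfolding c[symmetric] by (simp add: power2_eq_square field_simps)
    moreover have "(\<lambda>x. (b - x) / (b - a) * F) = (\<lambda>x. c * (b - x))" by (simp add: c_def mult.commute)
    ultimately show "((\<lambda>x. (b - x) / (b - a) * F) has_integral F * (b - a) / 2) {a..b}" by metis
    have "((\<lambda>x. c * (x - a)) has_integral c * (b\<^sup>2 / 2 - a * b) - c * (a\<^sup>2 / 2 - a * a)) {a..b}"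
      by (rule fundamental_theorem_of_calculus)
        (use ab in \<open>auto intro!: derivative_eq_intros simp flip: has_real_derivative_iff_has_vector_derivative\<close>)
    moreover have "c * (b\<^sup>2 / 2 - a * b) - c * (a\<^sup>2 / 2 - a * a) = F * (b - a) / 2"
      unfolding c[symmetric] by (simp add: power2_eq_square field_simps)
    moreover have "(\<lambda>x. (x - a) / (b - a) * F) = (\<lambda>x. c * (x - a))" by (simp add: c_def mult.commute)
    ultimately show "((\<lambda>x. (x - a) / (b - a) * F) has_integral F * (b - a) / 2) {a..b}" by metis
  qed
  show "0 \<le> p" "0 \<le> q"
    unfolding p_def q_def using ab g0 by (intro integral_nonneg hp hq; simp)+
  show "p \<le> F * (b - a) / 2"
    unfolding p_def using ab gF
    by (intro has_integral_le[OF integrable_integral[OF hp] half(1)] mult_left_mono) auto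
  show "q \<le> F * (b - a) / 2"
    unfolding q_def using ab gF
    by (intro has_integral_le[OF integrable_integral[OF hq] half(2)] mult_left_mono) auto
  have "p + q = integral {a..b} (\<lambda>x. (b - x) / (b - a) * g x + (x - a) / (b - a) * g x)"
    unfolding p_def q_def by (rule integral_add[symmetric, OF hp hq])
  also have "\<dots> = integral {a..b} g"
  proof (rule integral_cong)
    fix x
    have "(b - x) / (b - a) + (x - a) / (b - a) = 1" using ab by (simp add: add_divide_distrib[symmetric])
    then show "(b - x) / (b - a) * g x + (x - a) / (b - a) * g x = g x"
      by (metis distrib_right mult_1)
  qed
  finally show "p + q = integral {a..b} g" .
  have "(LINT x:{a..b}|lebesgue. ((b - x) / (b - a) * A + (x - a) / (b - a) * B) * g x)
    = (LINT x:{a..b}|lebesgue. A * ((b - x) / (b - a) * g x) + B * ((x - a) / (b - a) * g x))"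
    by (rule arg_cong[where f = "\<lambda>h. set_lebesgue_integral lebesgue {a..b} h"]) (auto simp: algebra_simps)
  also have "\<dots> = (LINT x:{a..b}|lebesgue. A * ((b - x) / (b - a) * g x)) + (LINT x:{a..b}|lebesgue. B * ((x - a) / (b - a) * g x))"
    by (rule set_integral_add) (use ip iq in \<open>auto intro: set_integrable_mult_right\<close>)
  also have "\<dots> = p * A + q * B"
    unfolding p_def q_def set_lebesgue_integral_eq_integral(2)[OF ip, symmetric]
      set_lebesgue_integral_eq_integral(2)[OF iq, symmetric] by (simp add: mult_ac)
  finally show "(LINT x:{a..b}|lebesgue. ((b - x) / (b - a) * A + (x - a) / (b - a) * B) * g x) = p * A + q * B" .
qed

text \<open>Adjacent cells are joined one at a time. The order of the nodes is carried through the
  induction because joining two intervals requires it. For \<open>n = 0\<close> there are already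
  two cells.\<close>

lemma sum_integral_mesh:
  fixes g :: "real \<Rightarrow> real" and y :: "int \<Rightarrow> real"
  assumes g: "g integrable_on UNIV" and y: "\<And>l. y l \<le> y (l + 1)"
  shows "y (-1) \<le> y (int n) \<and> (\<Sum>l = -1..int n. integral {y l..y (l + 1)} g) = integral {y (-1)..y (int n + 1)} g"
proof (induction n)
  have int: "g integrable_on {a..b}" for a b
    using integrable_on_subinterval[OF g] by simp
  {
    case 0
    have "{-1..0::int} = {-1, 0}" by auto
    moreover have "y (-1) \<le> y 0" "y 0 \<le> y 1" using y[of "-1"] y[of 0] by simp_all
    ultimately show ?case using Henstock_Kurzweil_Integration.integral_combine[OF _ _ int, of "y (-1)" "y 0" "y 1"] by simp
  next
    case (Suc n)
    have "{-1..int (Suc n)} = insert (int (Suc n)) {-1..int n}" by auto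
    then have "(\<Sum>l = -1..int (Suc n). integral {y l..y (l + 1)} g)
      = integral {y (-1)..y (int n + 1)} g + integral {y (int n + 1)..y (int n + 2)} g"
      using Suc by (simp add: add.commute)
    moreover have "y (-1) \<le> y (int n + 1)" "y (int n + 1) \<le> y (int n + 2)"
      using Suc y[of "int n"] y[of "int n + 1"] by (simp_all add: add.commute)
    ultimately show ?case
      using Henstock_Kurzweil_Integration.integral_combine[OF _ _ int, of "y (-1)" "y (int n + 1)" "y (int n + 2)"] by (simp add: add.commute)
  }
qed

text \<open>Jensen's inequality in variance form: the weighted sum of squared deviations from
  \<open>X\<close> is nonnegative, and as the total weight is at most 1 this gives
  \<open>X\<^sup>2 \<le> E\<close>. In \<open>E\<close> each node belongs to two cells and receives
  at most \<open>c / 2\<close> from each.\<close>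

lemma subaveraging_square_le:
  fixes v p q :: "int \<Rightarrow> real"
  assumes v0: "\<And>j. j \<notin> {0..m} \<Longrightarrow> v j = 0"
    and pq: "\<And>l. 0 \<le> p l" "\<And>l. 0 \<le> q l" "\<And>l. p l \<le> c / 2" "\<And>l. q l \<le> c / 2"
    and sum1: "(\<Sum>l = -1..m. p l + q l) \<le> 1"
  shows "(\<Sum>l = -1..m. p l * v l + q l * v (l + 1))\<^sup>2 \<le> c * (\<Sum>j = 0..m. (v j)\<^sup>2)"
proof -
  define X where "X = (\<Sum>l = -1..m. p l * v l + q l * v (l + 1))"
  define E where "E = (\<Sum>l = -1..m. p l * (v l)\<^sup>2 + q l * (v (l + 1))\<^sup>2)"
  have "0 \<le> (\<Sum>l = -1..m. p l * (v l - X)\<^sup>2 + q l * (v (l + 1) - X)\<^sup>2)"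
    by (intro sum_nonneg add_nonneg_nonneg mult_nonneg_nonneg pq) auto
  also have "\<dots> = E - 2 * X * X + X\<^sup>2 * (\<Sum>l = -1..m. p l + q l)"
  proof -
    have "E - 2 * X * (\<Sum>l = -1..m. p l * v l + q l * v (l + 1)) + X\<^sup>2 * (\<Sum>l = -1..m. p l + q l)
      = (\<Sum>l = -1..m. p l * (v l - X)\<^sup>2 + q l * (v (l + 1) - X)\<^sup>2)"
      unfolding E_def sum_distrib_left sum.distrib[symmetric] sum_subtractf[symmetric]
      by (rule sum.cong) (auto simp: power2_eq_square algebra_simps)
    then show ?thesis by (simp add: X_def)
  qed
  also have "\<dots> \<le> E - 2 * X * X + X\<^sup>2 * 1"
    using mult_left_mono[OF sum1, of "X\<^sup>2"] by simp
  finally have "X\<^sup>2 \<le> E" by (simp add: power2_eq_square)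
  also have "E \<le> (\<Sum>l = -1..m. c / 2 * (v l)\<^sup>2 + c / 2 * (v (l + 1))\<^sup>2)"
    unfolding E_def by (intro sum_mono add_mono mult_right_mono pq) auto
  also have "\<dots> = c / 2 * (\<Sum>l = -1..m. (v l)\<^sup>2) + c / 2 * (\<Sum>l = -1..m. (v (l + 1))\<^sup>2)"
    by (simp only: sum.distrib sum_distrib_left)
  also have "(\<Sum>l = -1..m. (v l)\<^sup>2) = (\<Sum>l = 0..m. (v l)\<^sup>2)"
    by (rule sum.mono_neutral_right) (use v0 in auto)
  also have "(\<Sum>l = -1..m. (v (l + 1))\<^sup>2) = (\<Sum>l = 0..m + 1. (v l)\<^sup>2)"
    by (rule sum.reindex_bij_witness[of _ "\<lambda>i. i - 1" "\<lambda>i. i + 1"]) auto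
  also have "\<dots> = (\<Sum>l = 0..m. (v l)\<^sup>2)"
    by (rule sum.mono_neutral_right) (use v0 in auto)
  finally show ?thesis by (simp add: X_def)
qed

text \<open>Cauchy-Schwarz followed by a bound uniform in \<open>j\<close>. The factor
  \<open>card J\<close> is harmless in the application, where \<open>c\<close> is proportional to
  the mesh width.\<close>

lemma sum_product_le_of_square_le:
  fixes v X :: "'a \<Rightarrow> real"
  assumes "\<And>j. j \<in> J \<Longrightarrow> (X j)\<^sup>2 \<le> c * (\<Sum>j\<in>J. (v j)\<^sup>2)" and "real (card J) * c \<le> d"
  shows "(\<Sum>j\<in>J. v j * X j) \<le> sqrt d * (\<Sum>j\<in>J. (v j)\<^sup>2)"
proof -
  let ?S = "\<Sum>j\<in>J. (v j)\<^sup>2"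
  have S: "0 \<le> ?S" by (intro sum_nonneg) auto
  have "(\<Sum>j\<in>J. v j * X j)\<^sup>2 \<le> ?S * (\<Sum>j\<in>J. (X j)\<^sup>2)"
    by (rule Cauchy_Schwarz_ineq_sum)
  also have "\<dots> \<le> ?S * (real (card J) * (c * ?S))"
    using sum_bounded_above[of J "\<lambda>j. (X j)\<^sup>2" "c * ?S"] assms(1) S by (intro mult_left_mono) auto
  also have "\<dots> = (real (card J) * c) * ?S\<^sup>2" by (simp add: power2_eq_square)
  also have "\<dots> \<le> d * ?S\<^sup>2" by (intro mult_right_mono assms(2)) auto
  finally have "(\<Sum>j\<in>J. v j * X j) \<le> sqrt (d * ?S\<^sup>2)" by (rule real_le_rsqrt)
  then show ?thesis using S by (simp add: real_sqrt_mult)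
qed

section \<open>Interpolation weights of a bounded density\<close>

locale bounded_density =
  fixes f :: "real \<Rightarrow> real"
  assumes nonneg: "\<And>\<xi>. f \<xi> \<ge> 0"
    and density: "has_bochner_integral lebesgue f 1"
    and bounded: "bounded (range f)"
begin

lemma le_SUP: "f x \<le> (SUP \<xi>. \<bar>f \<xi>\<bar>)"
proof -
  obtain K where "\<And>x. norm (f x) \<le> K" using bounded by (auto simp: bounded_iff)
  then have "bdd_above (range (\<lambda>\<xi>. \<bar>f \<xi>\<bar>))" by (auto simp: bdd_above_def)
  then have "\<bar>f x\<bar> \<le> (SUP \<xi>. \<bar>f \<xi>\<bar>)" by (intro cSUP_upper) auto
  then show ?thesis by simp
qed

lemma shift_absolutely_integrable: "(\<lambda>\<xi>. f (\<xi> - c)) absolutely_integrable_on UNIV"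
  and integral_shift: "integral UNIV (\<lambda>\<xi>. f (\<xi> - c)) = 1"
proof -
  have "has_bochner_integral lebesgue (\<lambda>\<xi>. f (\<xi> - c)) 1"
    using density has_bochner_integral_lebesgue_real_affine_iff[of 1 f 1 "- c"] by simp
  then have i: "integrable lebesgue (\<lambda>\<xi>. f (\<xi> - c))" "(LINT \<xi>|lebesgue. f (\<xi> - c)) = 1"
    by (auto simp: has_bochner_integral_iff)
  then show a: "(\<lambda>\<xi>. f (\<xi> - c)) absolutely_integrable_on UNIV"
    by (simp add: set_integrable_def)
  show "integral UNIV (\<lambda>\<xi>. f (\<xi> - c)) = 1"
    using set_lebesgue_integral_eq_integral(2)[OF a] i by (simp add: set_lebesgue_integral_def)
qed

lemma shift_integrable_interval:
  "(\<lambda>\<xi>. f (\<xi> - c)) absolutely_integrable_on {a..b::real}"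
  by (rule set_integrable_subset[OF shift_absolutely_integrable]) auto

text \<open>The denominators are node differences to match \<open>hat_weights\<close>; on the
  uniform mesh they equal the mesh width.\<close>

definition left_weight :: "(int \<Rightarrow> real) \<Rightarrow> int \<Rightarrow> int \<Rightarrow> real" where
  "left_weight y j l = integral {y l..y (l + 1)} (\<lambda>\<xi>. (y (l + 1) - \<xi>) / (y (l + 1) - y l) * f (\<xi> - y j))"

definition right_weight :: "(int \<Rightarrow> real) \<Rightarrow> int \<Rightarrow> int \<Rightarrow> real" where
  "right_weight y j l = integral {y l..y (l + 1)} (\<lambda>\<xi>. (\<xi> - y l) / (y (l + 1) - y l) * f (\<xi> - y j))"

lemma B_formula_eq:
  fixes m2 :: nat
  assumes "ymin < ymax"
  defines "y \<equiv> mesh_node ymin ymax m2"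
  shows "B_formula lam f ymin ymax m2 V i j
    = lam * (\<Sum>l = -1..int m2. left_weight y j l * V i l + right_weight y j l * V i (l + 1))"
proof -
  have d: "y (l + 1) - y l = mesh_width ymin ymax m2" for l
    by (simp add: y_def mesh_node_def algebra_simps)
  have h: "0 < mesh_width ymin ymax m2" using assms by (simp add: mesh_width_def)
  show ?thesis
    unfolding B_formula_def Let_def y_def[symmetric]
  proof (intro arg_cong2[where f = "(*)"] sum.cong refl)
    fix l
    have "y l < y (l + 1)" using d[of l] h by linarith
    from hat_weights(6)[OF shift_integrable_interval[where c = "y j"] this nonneg le_SUP, where A = "V i l" and B = "V i (l + 1)"]
    show "(LINT \<xi>:{y l..y (l + 1)}|lebesgue.
              ((y (l + 1) - \<xi>) / mesh_width ymin ymax m2 * V i l + (\<xi> - y l) / mesh_width ymin ymax m2 * V i (l + 1)) * f (\<xi> - y j))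
      = left_weight y j l * V i l + right_weight y j l * V i (l + 1)"
      unfolding left_weight_def right_weight_def d[symmetric, of l] .
  qed
qed

lemma B_formula_quadratic_le:
  fixes V :: "int \<Rightarrow> int \<Rightarrow> real"
  assumes y: "ymin < ymax" and lam: "0 \<le> lam"
    and v0: "\<And>j. j \<notin> {0..int m2} \<Longrightarrow> V i j = 0"
  shows "(\<Sum>j = 0..int m2. V i j * B_formula lam f ymin ymax m2 V i j)
    \<le> lam * sqrt ((ymax - ymin) * (SUP \<xi>. \<bar>f \<xi>\<bar>)) * (\<Sum>j = 0..int m2. (V i j)\<^sup>2)"
proof -
  define y where "y = mesh_node ymin ymax m2"
  define h where "h = mesh_width ymin ymax m2"
  define F where "F = (SUP \<xi>. \<bar>f \<xi>\<bar>)"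
  define X where "X j = (\<Sum>l = -1..int m2. left_weight y j l * V i l + right_weight y j l * V i (l + 1))" for j
  have h: "0 < h" using y by (simp add: h_def mesh_width_def)
  have d: "y (l + 1) - y l = h" for l
    by (simp add: y_def h_def mesh_node_def algebra_simps)
  have lt: "y l < y (l + 1)" for l using d[of l] h by linarith
  have "0 \<le> F" using order_trans[OF nonneg le_SUP] by (simp add: F_def)
  have X: "(X j)\<^sup>2 \<le> (F * h) * (\<Sum>j = 0..int m2. (V i j)\<^sup>2)" for j
    unfolding X_def
  proof (rule subaveraging_square_le)
    note hw = hat_weights[OF shift_integrable_interval[where c = "y j"] lt nonneg le_SUP, folded left_weight_def right_weight_def, unfolded d, folded F_def]
    show "0 \<le> left_weight y j l" "0 \<le> right_weight y j l"
      "left_weight y j l \<le> F * h / 2" "right_weight y j l \<le> F * h / 2" for l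
      using hw by auto
    have i: "(\<lambda>\<xi>. f (\<xi> - y j)) integrable_on UNIV"
      by (rule set_lebesgue_integral_eq_integral(1)[OF shift_absolutely_integrable])
    have "(\<Sum>l = -1..int m2. left_weight y j l + right_weight y j l)
      = (\<Sum>l = -1..int m2. integral {y l..y (l + 1)} (\<lambda>\<xi>. f (\<xi> - y j)))"
      using hw(5) by simp
    also have "\<dots> = integral {y (-1)..y (int m2 + 1)} (\<lambda>\<xi>. f (\<xi> - y j))"
      using sum_integral_mesh[OF i, of y m2] lt by (simp add: less_imp_le)
    \<comment> \<open>Cutting the integral to the domain only loses mass, so the weights are
      subprobability weights for every \<open>j\<close>.\<close>
    also have "\<dots> \<le> integral UNIV (\<lambda>\<xi>. f (\<xi> - y j))"
      by (rule integral_subset_le) (use i nonneg integrable_on_subinterval[OF i] in auto)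
    finally show "(\<Sum>l = -1..int m2. left_weight y j l + right_weight y j l) \<le> 1"
      using integral_shift by simp
  qed (use v0 in auto)
  have "(\<Sum>j = 0..int m2. V i j * X j) \<le> sqrt ((ymax - ymin) * F) * (\<Sum>j = 0..int m2. (V i j)\<^sup>2)"
  proof (rule sum_product_le_of_square_le[OF X])
    \<comment> \<open>There are \<open>m2 + 1\<close> interior nodes but \<open>m2 + 2\<close>
      cells, so the interior nodes times the width stay below the length of the domain.\<close>
    have "real (card {0..int m2}) * h \<le> ymax - ymin"
      using y by (simp add: h_def mesh_width_def field_simps)
    from mult_right_mono[OF this \<open>0 \<le> F\<close>]
    show "real (card {0..int m2}) * (F * h) \<le> (ymax - ymin) * F" by (simp add: algebra_simps)
  qed
  then have "lam * (\<Sum>j = 0..int m2. V i j * X j) \<le> lam * (sqrt ((ymax - ymin) * F) * (\<Sum>j = 0..int m2. (V i j)\<^sup>2))"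
    by (rule mult_left_mono) (rule lam)
  then show ?thesis
    unfolding B_formula_eq[OF y] X_def y_def F_def by (simp add: sum_distrib_left mult_ac)
qed

end

section \<open>Matrices of grid formulas\<close>

lemma sum_grid:
  fixes g :: "int \<Rightarrow> int \<Rightarrow> real"
  shows "(\<Sum>k = 0..<(m1 + 1) * (m2 + 1). g (int (k div (m2 + 1))) (int (k mod (m2 + 1))))
    = (\<Sum>i = 0..int m1. \<Sum>j = 0..int m2. g i j)"
proof -
  have "(\<Sum>k = 0..<(m1 + 1) * (m2 + 1). g (int (k div (m2 + 1))) (int (k mod (m2 + 1))))
    = (\<Sum>(i, j) \<in> {0..int m1} \<times> {0..int m2}. g i j)"
  proof (rule sum.reindex_bij_witness[of _ "\<lambda>(i, j). nat i * (m2 + 1) + nat j"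
        "\<lambda>k. (int (k div (m2 + 1)), int (k mod (m2 + 1)))"])
    fix k assume "k \<in> {0..<(m1 + 1) * (m2 + 1)}"
    then have "k div (m2 + 1) < m1 + 1" by (simp add: less_mult_imp_div_less)
    moreover have "k mod (m2 + 1) < m2 + 1" by simp
    ultimately show "(int (k div (m2 + 1)), int (k mod (m2 + 1))) \<in> {0..int m1} \<times> {0..int m2}"
      by auto
    show "(case (int (k div (m2 + 1)), int (k mod (m2 + 1))) of (i, j) \<Rightarrow> nat i * (m2 + 1) + nat j) = k"
      by (simp only: prod.case nat_int div_mult_mod_eq)
  next
    fix p assume "p \<in> {0..int m1} \<times> {0..int m2}"
    then obtain i j where p: "p = (int i, int j)" "i \<le> m1" "j \<le> m2"
      by (cases p) (auto simp: zero_le_imp_eq_int dest!: zero_le_imp_eq_int)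
    have "i * (m2 + 1) + j < (i + 1) * (m2 + 1)" using p by simp
    also have "\<dots> \<le> (m1 + 1) * (m2 + 1)" using p by (intro mult_right_mono) auto
    finally show "(case p of (i, j) \<Rightarrow> nat i * (m2 + 1) + nat j) \<in> {0..<(m1 + 1) * (m2 + 1)}"
      using p by simp
    have "(i * (m2 + 1) + j) div (m2 + 1) = i" "(i * (m2 + 1) + j) mod (m2 + 1) = j"
      using p by (simp_all add: div_mult_self3 mod_mult_self3 del: mult_Suc_right)
    then show "(int ((case p of (i, j) \<Rightarrow> nat i * (m2 + 1) + nat j) div (m2 + 1)),
        int ((case p of (i, j) \<Rightarrow> nat i * (m2 + 1) + nat j) mod (m2 + 1))) = p"
      using p by simp
  qed auto
  then show ?thesis by (simp add: sum.cartesian_product)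
qed

lemma grid_fun_eq_0: "i \<notin> {0..int m1} \<or> j \<notin> {0..int m2} \<Longrightarrow> grid_fun m1 m2 v i j = 0"
  by (auto simp: grid_fun_def)

lemma grid_fun_index:
  assumes "k < (m1 + 1) * (m2 + 1)"
  shows "grid_fun m1 m2 v (int (k div (m2 + 1))) (int (k mod (m2 + 1))) = v $ k"
proof -
  have "k div (m2 + 1) < m1 + 1" using assms by (simp add: less_mult_imp_div_less)
  moreover have "k mod (m2 + 1) < m2 + 1" by simp
  moreover have "k div (m2 + 1) * (m2 + 1) + k mod (m2 + 1) = k" by (rule div_mult_mod_eq)
  ultimately show ?thesis unfolding grid_fun_def by simp
qed

definition grid_linear :: "((int \<Rightarrow> int \<Rightarrow> real) \<Rightarrow> int \<Rightarrow> int \<Rightarrow> real) \<Rightarrow> bool" where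
  "grid_linear F \<longleftrightarrow> (\<forall>U V c i j. F (\<lambda>i j. U i j + c * V i j) i j = F U i j + c * F V i j)"

lemma grid_linear_sum:
  assumes "grid_linear F"
  shows "F (\<lambda>i j. \<Sum>l<n::nat. c l * U l i j) i j = (\<Sum>l<n. c l * F (U l) i j)"
proof (induction n)
  case 0
  \<comment> \<open>The value at the zero function is 0: the instance with both functions zero and
    factor -1 reads \<open>F 0 = F 0 - F 0\<close>.\<close>
  show ?case
    using assms[unfolded grid_linear_def, rule_format, of "\<lambda>i j. 0" "-1" "\<lambda>i j. 0" i j] by simp
next
  case (Suc n)
  then show ?case
    using assms[unfolded grid_linear_def, rule_format, of "\<lambda>i j. \<Sum>l<n. c l * U l i j" "c n" "U n" i j] by simp
qed

lemma grid_fun_expansion: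
  "grid_fun m1 m2 v = (\<lambda>i j. \<Sum>l<(m1 + 1) * (m2 + 1). v $ l * grid_fun m1 m2 (unit_vec ((m1 + 1) * (m2 + 1)) l) i j)"
proof (intro ext)
  fix i j
  let ?N = "(m1 + 1) * (m2 + 1)"
  show "grid_fun m1 m2 v i j = (\<Sum>l<?N. v $ l * grid_fun m1 m2 (unit_vec ?N l) i j)"
  proof (cases "0 \<le> i \<and> i \<le> int m1 \<and> 0 \<le> j \<and> j \<le> int m2")
    case True
    define k where "k = nat i * (m2 + 1) + nat j"
    have "nat j \<le> m2" using True by (simp add: nat_le_iff)
    then have "k < (nat i + 1) * (m2 + 1)" by (simp add: k_def)
    also have "\<dots> \<le> ?N" using True by (intro mult_right_mono) auto
    finally have k: "k < ?N" .
    have "(\<Sum>l<?N. v $ l * grid_fun m1 m2 (unit_vec ?N l) i j) = (\<Sum>l<?N. if l = k then v $ k else 0)"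
    proof (rule sum.cong)
      fix l assume "l \<in> {..<?N}"
      then have "grid_fun m1 m2 (unit_vec ?N l) i j = (if k = l then 1 else 0)"
        using True k unfolding grid_fun_def k_def[symmetric] by (simp only: index_unit_vec lessThan_iff) simp
      then show "v $ l * grid_fun m1 m2 (unit_vec ?N l) i j = (if l = k then v $ k else 0)" by simp
    qed simp
    also have "\<dots> = v $ k" using k by (subst sum.delta) auto
    finally show ?thesis using True by (simp add: grid_fun_def k_def)
  next
    case False
    then have "grid_fun m1 m2 u i j = 0" for u by (auto simp: grid_fun_def)
    then show ?thesis by simp
  qed
qed

lemma grid_matrix_carrier [simp]:
  "grid_matrix m1 m2 F \<in> carrier_mat ((m1 + 1) * (m2 + 1)) ((m1 + 1) * (m2 + 1))"
  by (simp add: grid_matrix_def Let_def)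

text \<open>The columns are the images of unit vectors, so linearity gives back the formula itself.
  From here on all estimates can be made on grid functions instead of matrix entries.\<close>

lemma grid_matrix_mult_vec:
  assumes F: "grid_linear F" and v: "v \<in> carrier_vec ((m1 + 1) * (m2 + 1))" and k: "k < (m1 + 1) * (m2 + 1)"
  shows "(grid_matrix m1 m2 F *\<^sub>v v) $ k = F (grid_fun m1 m2 v) (int (k div (m2 + 1))) (int (k mod (m2 + 1)))"
proof -
  let ?N = "(m1 + 1) * (m2 + 1)"
  have "F (grid_fun m1 m2 v) (int (k div (m2 + 1))) (int (k mod (m2 + 1)))
    = (\<Sum>l<?N. v $ l * F (grid_fun m1 m2 (unit_vec ?N l)) (int (k div (m2 + 1))) (int (k mod (m2 + 1))))"
    unfolding grid_linear_sum[OF F, symmetric] by (subst grid_fun_expansion) (rule refl)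
  also have "\<dots> = (\<Sum>l = 0..<?N. grid_matrix m1 m2 F $$ (k, l) * v $ l)"
    unfolding grid_matrix_def Let_def atLeast0LessThan
    by (rule sum.cong) (use k in \<open>auto simp del: mult_Suc mult_Suc_right\<close>)
  also have "\<dots> = (grid_matrix m1 m2 F *\<^sub>v v) $ k"
    using grid_matrix_carrier[of m1 m2 F] v k
    by (auto simp: scalar_prod_def simp del: mult_Suc mult_Suc_right intro!: sum.cong)
  finally show ?thesis by simp
qed

lemma scalar_prod_grid_matrix:
  assumes F: "grid_linear F" and v: "v \<in> carrier_vec ((m1 + 1) * (m2 + 1))"
  shows "scalar_prod v (grid_matrix m1 m2 F *\<^sub>v v)
    = (\<Sum>i = 0..int m1. \<Sum>j = 0..int m2. grid_fun m1 m2 v i j * F (grid_fun m1 m2 v) i j)"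
proof -
  let ?N = "(m1 + 1) * (m2 + 1)"
  have "scalar_prod v (grid_matrix m1 m2 F *\<^sub>v v) = (\<Sum>k = 0..<?N. v $ k * (grid_matrix m1 m2 F *\<^sub>v v) $ k)"
    using carrier_matD(1)[OF grid_matrix_carrier[of m1 m2 F]] by (simp add: scalar_prod_def)
  also have "\<dots> = (\<Sum>k = 0..<?N. (\<lambda>i j. grid_fun m1 m2 v i j * F (grid_fun m1 m2 v) i j)
      (int (k div (m2 + 1))) (int (k mod (m2 + 1))))"
    by (rule sum.cong) (simp_all only: grid_matrix_mult_vec[OF F v] grid_fun_index atLeastLessThan_iff)
  also have "\<dots> = (\<Sum>i = 0..int m1. \<Sum>j = 0..int m2. grid_fun m1 m2 v i j * F (grid_fun m1 m2 v) i j)"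
    by (rule sum_grid)
  finally show ?thesis .
qed

lemma scalar_prod_grid_fun:
  assumes v: "v \<in> carrier_vec ((m1 + 1) * (m2 + 1))"
  shows "scalar_prod v v = (\<Sum>i = 0..int m1. \<Sum>j = 0..int m2. (grid_fun m1 m2 v i j)\<^sup>2)"
proof -
  let ?N = "(m1 + 1) * (m2 + 1)"
  have "scalar_prod v v = (\<Sum>k = 0..<?N. v $ k * v $ k)" using v by (simp add: scalar_prod_def)
  also have "\<dots> = (\<Sum>k = 0..<?N. (\<lambda>i j. (grid_fun m1 m2 v i j)\<^sup>2) (int (k div (m2 + 1))) (int (k mod (m2 + 1))))"
    by (rule sum.cong) (simp_all only: grid_fun_index atLeastLessThan_iff power2_eq_square)
  also have "\<dots> = (\<Sum>i = 0..int m1. \<Sum>j = 0..int m2. (grid_fun m1 m2 v i j)\<^sup>2)"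
    by (rule sum_grid)
  finally show ?thesis .
qed

section \<open>The one-sided bound for the scheme matrix\<close>

lemma grid_linear_A_formula: "grid_linear (A_formula \<alpha> \<beta> \<sigma> lam \<mu> r w xmin xmax ymin ymax m1 m2)"
  unfolding grid_linear_def A_formula_def Let_def upwind_forward_def upwind_backward_def
  by (simp add: algebra_simps add_divide_distrib diff_divide_distrib)

text \<open>Splitting the integrals requires integrable pieces; \<open>B_formula_eq\<close> has
  settled this and leaves finite sums.\<close>

lemma (in bounded_density) grid_linear_B_formula:
  assumes "ymin < ymax"
  shows "grid_linear (B_formula lam f ymin ymax m2)"
  unfolding grid_linear_def B_formula_eq[OF assms]
  by (simp add: algebra_simps sum.distrib sum_distrib_left)

text \<open>The one-dimensional estimates are applied along each grid line, after swapping the sums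
  for the first direction. The wind coefficients drop by \<open>\<alpha> * dx\<close> and
  \<open>\<beta> * dy\<close> per node, which cancels the \<open>1 / dx\<close> and
  \<open>1 / dy\<close> of the differences and makes the bound independent of the mesh.\<close>

lemma A_formula_quadratic_le:
  fixes w :: "int \<Rightarrow> real" and V :: "int \<Rightarrow> int \<Rightarrow> real"
  assumes x: "xmin < xmax" and y: "ymin < ymax" and pos: "0 \<le> \<alpha>" "0 \<le> \<beta>"
    and w1: "w 1 = - w (-1) - 4 * w 2" and w0: "w 0 = 3 * w 2" and w2: "w 2 \<le> 0"
    and V0: "\<And>i j. i \<notin> {0..int m1} \<or> j \<notin> {0..int m2} \<Longrightarrow> V i j = 0"
  shows "(\<Sum>i = 0..int m1. \<Sum>j = 0..int m2.
      V i j * A_formula \<alpha> \<beta> \<sigma> lam \<mu> r w xmin xmax ymin ymax m1 m2 V i j)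
    \<le> ((\<bar>w (-1)\<bar> - 10 * w 2) * (\<alpha> + \<beta>) - (r + lam)) * (\<Sum>i = 0..int m1. \<Sum>j = 0..int m2. (V i j)\<^sup>2)"
proof -
  let ?S = "\<lambda>g. \<Sum>i = 0..int m1. \<Sum>j = 0..int m2. (g i j :: real)"
  define dx dy where "dx = mesh_width xmin xmax m1" and "dy = mesh_width ymin ymax m2"
  define a b where "a i = \<alpha> * (\<mu> - mesh_node xmin xmax m1 i)" and "b j = - \<beta> * mesh_node ymin ymax m2 j" for i j
  have h: "0 < dx" "0 < dy" using x y by (simp_all add: dx_def dy_def mesh_width_def)
  have step: "a (i + 1) = a i - \<alpha> * dx" "b (i + 1) = b i - \<beta> * dy" for i
    by (simp_all add: a_def b_def dx_def dy_def mesh_node_def algebra_simps)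
  define D where "D i j = V i j * (V (i - 1) j - 2 * V i j + V (i + 1) j)" for i j
  define P where "P i j = V i j * (pos_part (a i) * upwind_forward w (\<lambda>k. V k j) i
    + neg_part (a i) * upwind_backward w (\<lambda>k. V k j) i)" for i j
  define Q where "Q i j = V i j * (pos_part (b j) * upwind_forward w (\<lambda>k. V i k) j
    + neg_part (b j) * upwind_backward w (\<lambda>k. V i k) j)" for i j
  define c where "c = \<bar>w (-1)\<bar> - 10 * w 2"
  have split: "v * (s / 2 * (d / e) - R * v + p * (g / dx) + n * (g' / dx) + q * (k / dy) + q' * (k' / dy))
    = s / 2 / e * (v * d) + 1 / dx * (v * (p * g + n * g')) + 1 / dy * (v * (q * k + q' * k')) - R * v\<^sup>2"
    for v s d e R p g n g' q k q' k' :: real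
    by (simp add: algebra_simps add_divide_distrib power2_eq_square)
  have "?S (\<lambda>i j. V i j * A_formula \<alpha> \<beta> \<sigma> lam \<mu> r w xmin xmax ymin ymax m1 m2 V i j)
    = ?S (\<lambda>i j. \<sigma>\<^sup>2 / 2 / dx\<^sup>2 * D i j + 1 / dx * P i j + 1 / dy * Q i j - (r + lam) * (V i j)\<^sup>2)"
    unfolding A_formula_def Let_def dx_def[symmetric] dy_def[symmetric]
      a_def[symmetric] b_def[symmetric] D_def P_def Q_def
    by (intro sum.cong refl split)
  also have "\<dots> = \<sigma>\<^sup>2 / 2 / dx\<^sup>2 * ?S D + 1 / dx * ?S P + 1 / dy * ?S Q - (r + lam) * ?S (\<lambda>i j. (V i j)\<^sup>2)"
    by (simp only: sum.distrib sum_subtractf sum_distrib_left)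
  also have "\<dots> \<le> 0 + c * \<alpha> * ?S (\<lambda>i j. (V i j)\<^sup>2) + c * \<beta> * ?S (\<lambda>i j. (V i j)\<^sup>2) - (r + lam) * ?S (\<lambda>i j. (V i j)\<^sup>2)"
  proof (intro diff_mono add_mono order_refl)
    have "?S D \<le> 0"
      unfolding D_def by (subst sum.swap) (intro sum_nonpos sum_second_difference_le V0, simp)
    then show "\<sigma>\<^sup>2 / 2 / dx\<^sup>2 * ?S D \<le> 0" by (intro mult_nonneg_nonpos) auto
    have "?S P = (\<Sum>j = 0..int m2. \<Sum>i = 0..int m1. P i j)" by (rule sum.swap)
    also have "\<dots> \<le> (\<Sum>j = 0..int m2. c * (\<alpha> * dx) * (\<Sum>i = 0..int m1. (V i j)\<^sup>2))"
      unfolding P_def c_def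
      by (intro sum_mono sum_upwind_le V0 step w1 w0 w2) (use h pos in auto)
    also have "\<dots> = c * (\<alpha> * dx) * ?S (\<lambda>i j. (V i j)\<^sup>2)"
      unfolding sum_distrib_left[symmetric] by (subst sum.swap) (rule refl)
    finally show "1 / dx * ?S P \<le> c * \<alpha> * ?S (\<lambda>i j. (V i j)\<^sup>2)"
      using h by (simp add: field_simps)
    have "?S Q \<le> (\<Sum>i = 0..int m1. c * (\<beta> * dy) * (\<Sum>j = 0..int m2. (V i j)\<^sup>2))"
      unfolding Q_def c_def
      by (intro sum_mono sum_upwind_le V0 step w1 w0 w2) (use h pos in auto)
    also have "\<dots> = c * (\<beta> * dy) * ?S (\<lambda>i j. (V i j)\<^sup>2)"
      by (simp only: sum_distrib_left)
    finally show "1 / dy * ?S Q \<le> c * \<beta> * ?S (\<lambda>i j. (V i j)\<^sup>2)"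
      using h by (simp add: field_simps)
  qed
  also have "\<dots> = (c * (\<alpha> + \<beta>) - (r + lam)) * ?S (\<lambda>i j. (V i j)\<^sup>2)"
    by (simp add: algebra_simps)
  finally show ?thesis by (simp add: c_def)
qed

lemma (in bounded_density) scheme_matrix_dissipative:
  fixes w :: "int \<Rightarrow> real" and v :: "real vec"
  assumes pos: "0 \<le> \<alpha>" "0 \<le> \<beta>" "0 \<le> lam" and x: "xmin < xmax" and y: "ymin < ymax"
    and w1: "w 1 = - w (-1) - 4 * w 2" and w0: "w 0 = 3 * w 2" and w2: "w 2 \<le> 0"
    and v: "v \<in> carrier_vec ((m1 + 1) * (m2 + 1))"
  shows "scalar_prod v ((A_matrix \<alpha> \<beta> \<sigma> lam \<mu> r w xmin xmax ymin ymax m1 m2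
      + B_matrix lam f ymin ymax m1 m2) *\<^sub>v v) \<le> C_hat \<alpha> \<beta> lam r w f ymin ymax * scalar_prod v v"
proof -
  let ?N = "(m1 + 1) * (m2 + 1)"
  let ?A = "A_matrix \<alpha> \<beta> \<sigma> lam \<mu> r w xmin xmax ymin ymax m1 m2"
  let ?B = "B_matrix lam f ymin ymax m1 m2"
  define V where "V = grid_fun m1 m2 v"
  have V0: "V i j = 0" if "i \<notin> {0..int m1} \<or> j \<notin> {0..int m2}" for i j
    using grid_fun_eq_0[OF that] by (simp add: V_def)
  have AB: "?A \<in> carrier_mat ?N ?N" "?B \<in> carrier_mat ?N ?N"
    unfolding A_matrix_def B_matrix_def by (rule grid_matrix_carrier)+
  have vv: "scalar_prod v v = (\<Sum>i = 0..int m1. \<Sum>j = 0..int m2. (V i j)\<^sup>2)"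
    unfolding V_def by (rule scalar_prod_grid_fun[OF v])
  have "scalar_prod v (?A *\<^sub>v v) \<le> ((\<bar>w (-1)\<bar> - 10 * w 2) * (\<alpha> + \<beta>) - (r + lam)) * scalar_prod v v"
    unfolding A_matrix_def scalar_prod_grid_matrix[OF grid_linear_A_formula v] vv V_def[symmetric]
    by (rule A_formula_quadratic_le[OF x y pos(1,2) w1 w0 w2 V0])
  moreover have "scalar_prod v (?B *\<^sub>v v) \<le> lam * sqrt ((ymax - ymin) * (SUP \<xi>. \<bar>f \<xi>\<bar>)) * scalar_prod v v"
  proof -
    have "scalar_prod v (?B *\<^sub>v v) \<le> (\<Sum>i = 0..int m1.
        lam * sqrt ((ymax - ymin) * (SUP \<xi>. \<bar>f \<xi>\<bar>)) * (\<Sum>j = 0..int m2. (V i j)\<^sup>2))"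
      unfolding B_matrix_def scalar_prod_grid_matrix[OF grid_linear_B_formula[OF y] v] V_def[symmetric]
      by (intro sum_mono B_formula_quadratic_le[OF y pos(3)] V0) simp
    then show ?thesis by (simp only: vv sum_distrib_left)
  qed
  moreover have "scalar_prod v ((?A + ?B) *\<^sub>v v) = scalar_prod v (?A *\<^sub>v v) + scalar_prod v (?B *\<^sub>v v)"
    using AB v by (simp add: add_mult_distrib_mat_vec[of _ ?N ?N] scalar_prod_add_distrib[of _ ?N] del: mult_Suc mult_Suc_right)
  ultimately show ?thesis by (simp add: C_hat_def algebra_simps)
qed

section \<open>The induced norm and the stability estimate\<close>

lemma grid_norm_eq: "grid_norm dx dy v = sqrt (dx * dy) * sqrt (scalar_prod v v)"
  by (simp add: grid_norm_def scalar_prod_def lessThan_atLeast0 real_sqrt_mult)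

text \<open>The factor \<open>sqrt (dx * dy)\<close> cancels in the quotient. The lower bound is
  what allows powers of the norm to be compared; it takes a nonzero vector, hence
  \<open>0 < N\<close>, and the boundedness of the quotients.\<close>

lemma grid_matrix_norm_bounds:
  fixes M :: "real mat"
  assumes M: "M \<in> carrier_mat N N" and N: "0 < N" and d: "0 < dx" "0 < dy"
    and bound: "\<And>v. v \<in> carrier_vec N \<Longrightarrow> scalar_prod (M *\<^sub>v v) (M *\<^sub>v v) \<le> L\<^sup>2 * scalar_prod v v"
    and L: "0 \<le> L"
  shows "0 \<le> grid_matrix_norm dx dy M" and "grid_matrix_norm dx dy M \<le> L"
proof -
  let ?Q = "\<lambda>v. grid_norm dx dy (M *\<^sub>v v) / grid_norm dx dy v"
  let ?X = "{v \<in> carrier_vec (dim_col M). v \<noteq> 0\<^sub>v (dim_col M)}"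
  have Q: "?Q v \<le> L" if "v \<in> ?X" for v
  proof -
    have v: "v \<in> carrier_vec N" "v \<noteq> 0\<^sub>v N" using that M by auto
    then have "0 < scalar_prod v v"
      using scalar_prod_self_eq_0[of v N] scalar_prod_self_nonneg[of v] by force
    moreover have "sqrt (scalar_prod (M *\<^sub>v v) (M *\<^sub>v v)) \<le> L * sqrt (scalar_prod v v)"
      using real_sqrt_le_mono[OF bound[OF v(1)]] L by (simp add: real_sqrt_mult)
    ultimately show ?thesis using d by (simp add: grid_norm_eq divide_simps)
  qed
  have ne: "unit_vec N 0 \<in> ?X" using M N by (auto dest: arg_cong[where f = "\<lambda>v. v $ 0"])
  show "grid_matrix_norm dx dy M \<le> L"
    unfolding grid_matrix_norm_def by (rule cSUP_least) (use ne Q in auto)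
  have "0 \<le> ?Q (unit_vec N 0)"
    using d by (simp add: grid_norm_eq scalar_prod_self_nonneg)
  also have "\<dots> \<le> grid_matrix_norm dx dy M"
    unfolding grid_matrix_norm_def by (rule cSUP_upper[OF ne]) (use Q in \<open>auto simp: bdd_above_def\<close>)
  finally show "0 \<le> grid_matrix_norm dx dy M" .
qed

theorem theorem9:
  fixes \<alpha> \<beta> \<sigma> lam \<mu> r xmin xmax ymin ymax \<theta> \<nu> T :: real
    and f :: "real \<Rightarrow> real" and w :: "int \<Rightarrow> real"
  assumes "\<alpha> > 0" and "\<beta> > 0" and "\<sigma> > 0" and "lam > 0"
    and f_nonneg: "\<And>\<xi>. f \<xi> \<ge> 0"
    and f_density: "has_bochner_integral lebesgue f 1"
    and f_bounded: "bounded (range f)"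
    and "(\<Sum>k = -1..2. w k) = 0"
    and "(\<Sum>k = -1..2. of_int k * w k) = 1"
    and "(\<Sum>k = -1..2. (of_int k)\<^sup>2 * w k) = 0"
    and "w 2 \<le> 0"
    and "xmin < xmax" and "ymin < ymax"
    and "1 / 4 \<le> \<theta>" and "\<theta> \<le> 1 / 2"
    and "0 < \<nu>" and "\<nu> < 1 / \<theta>"
    and "T > 0"
  shows "\<exists>\<gamma>::real. \<forall>(dt::real) m1 m2 n.
    (let dx = mesh_width xmin xmax m1;
         dy = mesh_width ymin ymax m2;
         a = (\<lambda>i. \<alpha> * (\<mu> - mesh_node xmin xmax m1 i));
         b = (\<lambda>j. - \<beta> * mesh_node ymin ymax m2 j);
         C = C_hat \<alpha> \<beta> lam r w f ymin ymax;
         M = dt \<cdot>\<^sub>m (A_matrix \<alpha> \<beta> \<sigma> lam \<mu> r w xmin xmax ymin ymax m1 m2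
                   + B_matrix lam f ymin ymax m1 m2)
     in dt > 0 \<longrightarrow>
        a 0 > 0 \<longrightarrow> 0 > a (int m1) \<longrightarrow> b 0 > 0 \<longrightarrow> 0 > b (int m2) \<longrightarrow>
        real n * dt \<le> T \<longrightarrow> C * dt \<le> \<nu> \<longrightarrow>
        invertible_mat (1\<^sub>m (dim_row M) - \<theta> \<cdot>\<^sub>m M) \<and>
        grid_matrix_norm dx dy (dirk_R \<theta> M) ^ n \<le> exp (\<gamma> * T * max C 0))"
proof -
  interpret bounded_density f
    using f_nonneg f_density f_bounded by unfold_locales
  \<comment> \<open>The witness for \<open>\<gamma>\<close> depends on \<open>\<theta>\<close> and
    \<open>\<nu>\<close> only. It is half of the 76 in the one-step bound, since that bound concerns
    squared norms.\<close>
  define \<kappa> where "\<kappa> = 38 / (1 - \<theta> * \<nu>) ^ 4"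
  define C where "C = C_hat \<alpha> \<beta> lam r w f ymin ymax"
  have "0 < 1 - \<theta> * \<nu>" using \<open>\<nu> < 1 / \<theta>\<close> \<open>1 / 4 \<le> \<theta>\<close> by (simp add: field_simps)
  then have \<kappa>: "0 \<le> \<kappa>" by (simp add: \<kappa>_def)
  note w = upwind_weights[OF assms(8,10)]
  have main: "invertible_mat (1\<^sub>m (dim_row M) - \<theta> \<cdot>\<^sub>m M) \<and>
      grid_matrix_norm (mesh_width xmin xmax m1) (mesh_width ymin ymax m2) (dirk_R \<theta> M) ^ n
        \<le> exp (\<kappa> * T * max C 0)"
    if dt: "dt > 0" and n: "real n * dt \<le> T" and Cdt: "C * dt \<le> \<nu>"
      and M: "M = dt \<cdot>\<^sub>m (A_matrix \<alpha> \<beta> \<sigma> lam \<mu> r w xmin xmax ymin ymax m1 m2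
        + B_matrix lam f ymin ymax m1 m2)"
    for dt :: real and m1 m2 n :: nat and M
  proof -
    let ?N = "(m1 + 1) * (m2 + 1)"
    let ?AB = "A_matrix \<alpha> \<beta> \<sigma> lam \<mu> r w xmin xmax ymin ymax m1 m2 + B_matrix lam f ymin ymax m1 m2"
    \<comment> \<open>Truncating \<open>C\<close> at 0 makes \<open>c\<close> nonnegative, and
      \<open>c \<le> \<nu>\<close> survives because \<open>\<nu>\<close> is positive.\<close>
    define c where "c = max C 0 * dt"
    have c: "0 \<le> c" "c \<le> \<nu>" using dt Cdt \<open>0 < \<nu>\<close> by (auto simp: c_def max_def)
    have AB: "?AB \<in> carrier_mat ?N ?N"
      unfolding A_matrix_def B_matrix_def by (intro add_carrier_mat grid_matrix_carrier)
    then have MN: "M \<in> carrier_mat ?N ?N" unfolding M by (rule smult_carrier_mat)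
    have diss: "scalar_prod v (M *\<^sub>v v) \<le> c * scalar_prod v v" if v: "v \<in> carrier_vec ?N" for v
    proof -
      have "scalar_prod v (M *\<^sub>v v) = dt * scalar_prod v (?AB *\<^sub>v v)"
        unfolding M smult_mat_mult_vec[OF AB v]
        by (rule scalar_prod_smult_right) (use AB v in auto)
      also have "\<dots> \<le> dt * (C * scalar_prod v v)"
        unfolding C_def using assms(1,2,4) dt
        by (intro mult_left_mono scheme_matrix_dissipative[OF _ _ _ assms(12,13) w assms(11) v]) auto
      also have "\<dots> \<le> dt * (max C 0 * scalar_prod v v)"
        using dt by (intro mult_left_mono mult_right_mono scalar_prod_self_nonneg) auto
      finally show ?thesis by (simp add: c_def mult_ac)
    qed
    have stable: "invertible_mat (1\<^sub>m ?N - \<theta> \<cdot>\<^sub>m M)" "dirk_R \<theta> M \<in> carrier_mat ?N ?N"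
      "\<And>v. v \<in> carrier_vec ?N \<Longrightarrow> scalar_prod (dirk_R \<theta> M *\<^sub>v v) (dirk_R \<theta> M *\<^sub>v v)
        \<le> (1 + 76 / (1 - \<theta> * \<nu>) ^ 4 * c) * scalar_prod v v"
      using dirk_R_stable[OF MN diss c assms(14,15,17)] by blast+
    define L where "L = exp (\<kappa> * c)"
    have L: "scalar_prod (dirk_R \<theta> M *\<^sub>v v) (dirk_R \<theta> M *\<^sub>v v) \<le> L\<^sup>2 * scalar_prod v v"
      if v: "v \<in> carrier_vec ?N" for v
    proof -
      have "1 + 2 * (\<kappa> * c) \<le> exp (2 * (\<kappa> * c))" by (rule exp_ge_add_one_self)
      also have "\<dots> = L\<^sup>2" by (simp add: L_def exp_double)
      finally have "(1 + 76 / (1 - \<theta> * \<nu>) ^ 4 * c) * scalar_prod v v \<le> L\<^sup>2 * scalar_prod v v"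
        by (intro mult_right_mono scalar_prod_self_nonneg) (simp add: \<kappa>_def)
      with stable(3)[OF v] show ?thesis by linarith
    qed
    have d: "0 < mesh_width xmin xmax m1" "0 < mesh_width ymin ymax m2"
      using assms(12,13) by (simp_all add: mesh_width_def)
    have N: "0 < ?N" by simp
    have L0: "0 \<le> L" by (simp add: L_def)
    have "grid_matrix_norm (mesh_width xmin xmax m1) (mesh_width ymin ymax m2) (dirk_R \<theta> M) ^ n \<le> L ^ n"
      by (rule power_mono) (use grid_matrix_norm_bounds[OF stable(2) N d L L0] in auto)
    \<comment> \<open>The \<open>n\<close> steps add up to the elapsed time \<open>n * dt\<close>,
      which is at most \<open>T\<close>.\<close>
    also have "L ^ n = exp (\<kappa> * max C 0 * (real n * dt))"
      by (simp add: L_def c_def exp_of_nat_mult[symmetric] mult_ac)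
    also have "\<dots> \<le> exp (\<kappa> * T * max C 0)"
      using mult_left_mono[OF n, of "\<kappa> * max C 0"] \<kappa> by (simp add: mult_ac)
    finally show ?thesis using stable(1) MN by auto
  qed
  show ?thesis
    unfolding Let_def C_def[symmetric] using main by blast
qed

end
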